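(* There exist a flux $A(x,u)$ satisfying assumptions (A-1)--(A-3) and (B-1)--(B-4) listed in the context and an initial datum $u_0$ with $\Lambda(u_0)<\infty$ ($\Lambda$ defined in the context) such that the corresponding adapted entropy solution $u$ of $u_t+A(x,u)_x=0$, $u(0,\cdot)=u_0$, has total variation blow-up at some finite time $T_0>0$, i.e. $TV(u(T_0,\cdot))=\infty$.
   Context: $BV(\mathbb{R})$ denotes functions on $\mathbb{R}$ of finite total variation $TV$. Assumptions on $A:\mathbb{R}\times\mathbb{R}\to\mathbb{R}$: (A-1) $A$ is continuous on $(\mathbb{R}\setminus\Omega)\times\mathbb{R}$, where $\Omega\subset\mathbb{R}$ is a closed set of measure zero. (A-2) There is a locally bounded $q:\mathbb{R}\to\mathbb{R}$ such that $|A(x,u)-A(x,v)|\le q(R)|u-v|$ for a.e. $x\in\mathbb{R}$ and all $u,v\in[-R,R]$, $R>0$. (A-3) There are functions $u_M^\pm:\mathbb{R}\to\mathbb{R}$, continuous on $\mathbb{R}\setminus\Omega$, with $u_M^-(x)\le u_M^+(x)$ for $x\in\mathbb{R}\setminus\Omega$, such that $A(x,\cdot)$ is decreasing on $(-\infty,u_M^-(x)]$, increasing on $[u_M^+(x),\infty)$, and $A(x,z)=0$ for all $u_M^-(x)\le z\le u_M^+(x)$; here $[u_M^-(x),u_M^+(x)]$ is exactly the zero set of $A(x,\cdot)$. (B-1) There are a continuous function $\eta:\mathbb{R}\to\mathbb{R}$ and a function $a\in BV(\mathbb{R})$ such that $|A(x,u)-A(y,u)|\le\eta(u)|a(x)-a(y)|$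 for all $x,y,u\in\mathbb{R}$. (B-2) $u\mapsto A(x,u)$ is convex for each $x\in\mathbb{R}$. (B-3) There are non-negative convex functions $B_1,B_2$ with $B_1(u)\le|A(x,u)|\le B_2(u)$ for all $x,u$, and $\lim_{|u|\to\infty}B_1(u)=\infty$. (B-4) With $u_M:=(u_M^-+u_M^+)/2$, one has $u_M\in BV(\mathbb{R})$ and $u_M^+-u_M^-\in BV(\mathbb{R})$. Stationary states: for $\alpha\ge0$, $k_\alpha^-(x)\le u_M^-(x)$ and $k_\alpha^+(x)\ge u_M^+(x)$ are defined by $A(x,k_\alpha^\pm(x))=\alpha$. For $\alpha>0$ let $\mathscr S_\alpha=\{k_\alpha^+,k_\alpha^-\}$; let $\mathscr S_0$ be the set of all (measurable) functions $k$ with $u_M^-(x)\le k(x)\le u_M^+(x)$ for all $x$. Adapted entropy solution with initial data $u_0$: a function $u\in L^\infty((0,\infty)\times\mathbb{R})$, with $u\in C([0,T];L^1_{loc}(\mathbb{R}))$ for all $T>0$, such that for all $\alpha\ge0$, all $k_\alpha\in\mathscr S_\alpha$ and all $0\le\phi\in C_c^\infty([0,\infty)\times\mathbb{R})$, $$\int_0^\infty\!\!\int_{\mathbb{R}}|u-k_\alpha(x)|\phi_t+\operatorname{sgn}(u-k_\alpha(x))\,(A(x,u)-\alpha)\,\phi_x\,dx\,dt+\int_{\mathbb{R}}|u_0(x)-k_\alpha(x)|\phi(0,x)\,dx\ge0.$$ Definition of $\Lambda$: for $b\in L^\infty(\mathbb{R})$ and $-\infty<x_1<\dots<x_{n+1}<\infty$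 put, for $1\le j\le n$, $$\Delta w_j:=\begin{cases}|b(x_j)-b(x_{j+1})| & \text{if }A(x_j,\cdot)=A(x_{j+1},\cdot),\\ |b(x_j)-u_M(x_j)|+|b(x_{j+1})-u_M(x_{j+1})| & \text{if }A(x_j,\cdot)\ne A(x_{j+1},\cdot),\end{cases}$$ and $\Lambda(b):=\sup\sum_{j=1}^n\Delta w_j$, the supremum being over all $n$ and all $-\infty<x_1<\dots<x_{n+1}<\infty$. (Since $u_M\in BV(\mathbb{R})$, $\Lambda(b)<\infty$ implies $b\in BV(\mathbb{R})$.) *)

theory Defs
  imports "HOL-Analysis.Analysis"
begin

text \<open>
  Scalar conservation laws \<open>u\<^sub>t + A(x,u)\<^sub>x = 0\<close> on the real line whose flux may depend
  discontinuously on \<open>x\<close>. The flux is a curried function \<open>A x u\<close>; \<open>um\<close>, \<open>up\<close> stand for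
  \<open>u\<^sub>M\<^sup>-\<close>, \<open>u\<^sub>M\<^sup>+\<close>, and a solution is a curried function \<open>u t x\<close>.
\<close>

section \<open>Total variation\<close>

text \<open>A pair \<open>(n, x)\<close> encodes the points \<open>x 1 < \<dots> < x (n+1)\<close>.\<close>

definition chains :: "(nat \<times> (nat \<Rightarrow> real)) set" where
  "chains = {(n, x). 1 \<le> n \<and> strict_mono_on {1..Suc n} x}"

definition TV :: "(real \<Rightarrow> real) \<Rightarrow> ereal" where
  "TV f = (SUP (n, x) \<in> chains. ereal (\<Sum>j=1..n. \<bar>f (x j) - f (x (Suc j))\<bar>))"

definition BV :: "(real \<Rightarrow> real) set" where
  "BV = {f. TV f < \<infinity>}"

text \<open>
  For a function that is only determined almost everywhere, such as a time slice of a solution,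
  the total variation is that of the best representative. In particular it is infinite iff no
  representative has finite variation, so that it cannot be made infinite by changing values
  on a null set.
\<close>

definition ess_TV :: "(real \<Rightarrow> real) \<Rightarrow> ereal" where
  "ess_TV f = (INF g \<in> {g. AE x in lebesgue. g x = f x}. TV g)"


section \<open>Assumptions on the flux\<close>

definition A1 :: "(real \<Rightarrow> real \<Rightarrow> real) \<Rightarrow> real set \<Rightarrow> bool" where
  "A1 A \<Omega> \<longleftrightarrow> closed \<Omega> \<and> negligible \<Omega> \<and> continuous_on ((- \<Omega>) \<times> UNIV) (\<lambda>(x, u). A x u)"

definition A2 :: "(real \<Rightarrow> real \<Rightarrow> real) \<Rightarrow> bool" where
  "A2 A \<longleftrightarrow> (\<exists>q :: real \<Rightarrow> real. (\<forall>K. compact K \<longrightarrow> bounded (q ` K)) \<and>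
     (AE x in lebesgue. \<forall>R>0. \<forall>u\<in>{-R..R}. \<forall>v\<in>{-R..R}. \<bar>A x u - A x v\<bar> \<le> q R * \<bar>u - v\<bar>))"

text \<open>
  Monotonicity is strict, which is what makes \<open>k\<^sub>\<alpha>\<^sup>\<plusminus>\<close> below well defined. Strict monotonicity
  at every \<open>x\<close> also forces \<open>um x \<le> up x\<close> at the points of \<open>\<Omega>\<close>: if \<open>up x < um x\<close>, then
  \<open>A x\<close> would be both strictly decreasing and strictly increasing on \<open>{up x..um x}\<close>.
\<close>

definition A3 :: "(real \<Rightarrow> real \<Rightarrow> real) \<Rightarrow> real set \<Rightarrow> (real \<Rightarrow> real) \<Rightarrow> (real \<Rightarrow> real) \<Rightarrow> bool" where
  "A3 A \<Omega> um up \<longleftrightarrow>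
     continuous_on (- \<Omega>) um \<and> continuous_on (- \<Omega>) up \<and> (\<forall>x\<in>- \<Omega>. um x \<le> up x) \<and>
     (\<forall>x. strict_antimono_on {..um x} (A x) \<and> strict_mono_on {up x..} (A x) \<and>
          {z. A x z = 0} = {um x..up x})"

definition uM :: "(real \<Rightarrow> real) \<Rightarrow> (real \<Rightarrow> real) \<Rightarrow> real \<Rightarrow> real" where
  "uM um up x = (um x + up x) / 2"

definition B1 :: "(real \<Rightarrow> real \<Rightarrow> real) \<Rightarrow> bool" where
  "B1 A \<longleftrightarrow> (\<exists>\<eta> a. continuous_on UNIV \<eta> \<and> a \<in> BV \<and>
     (\<forall>x y u. \<bar>A x u - A y u\<bar> \<le> \<eta> u * \<bar>a x - a y\<bar>))"

definition B2 :: "(real \<Rightarrow> real \<Rightarrow> real) \<Rightarrow> bool" where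
  "B2 A \<longleftrightarrow> (\<forall>x. convex_on UNIV (A x))"

definition B3 :: "(real \<Rightarrow> real \<Rightarrow> real) \<Rightarrow> bool" where
  "B3 A \<longleftrightarrow> (\<exists>b1 b2 :: real \<Rightarrow> real.
     convex_on UNIV b1 \<and> convex_on UNIV b2 \<and> (\<forall>u. 0 \<le> b1 u) \<and> (\<forall>u. 0 \<le> b2 u) \<and>
     (\<forall>x u. b1 u \<le> \<bar>A x u\<bar> \<and> \<bar>A x u\<bar> \<le> b2 u) \<and> filterlim b1 at_top at_infinity)"

definition B4 :: "(real \<Rightarrow> real) \<Rightarrow> (real \<Rightarrow> real) \<Rightarrow> bool" where
  "B4 um up \<longleftrightarrow> uM um up \<in> BV \<and> (\<lambda>x. up x - um x) \<in> BV"


section \<open>Stationary states\<close>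

definition k_minus :: "(real \<Rightarrow> real \<Rightarrow> real) \<Rightarrow> (real \<Rightarrow> real) \<Rightarrow> real \<Rightarrow> real \<Rightarrow> real" where
  "k_minus A um \<alpha> x = (THE k. k \<le> um x \<and> A x k = \<alpha>)"

definition k_plus :: "(real \<Rightarrow> real \<Rightarrow> real) \<Rightarrow> (real \<Rightarrow> real) \<Rightarrow> real \<Rightarrow> real \<Rightarrow> real" where
  "k_plus A up \<alpha> x = (THE k. up x \<le> k \<and> A x k = \<alpha>)"

definition stationary_states ::
  "(real \<Rightarrow> real \<Rightarrow> real) \<Rightarrow> (real \<Rightarrow> real) \<Rightarrow> (real \<Rightarrow> real) \<Rightarrow> real \<Rightarrow> (real \<Rightarrow> real) set" where
  "stationary_states A um up \<alpha> =
     (if \<alpha> = 0 then {k \<in> borel_measurable lebesgue. \<forall>x. um x \<le> k x \<and> k x \<le> up x}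
      else {k_plus A up \<alpha>, k_minus A um \<alpha>})"


section \<open>Adapted entropy solutions\<close>

fun Ck :: "nat \<Rightarrow> ('a::real_normed_vector \<Rightarrow> real) \<Rightarrow> bool" where
  "Ck 0 f \<longleftrightarrow> continuous_on UNIV f"
| "Ck (Suc m) f \<longleftrightarrow> (\<forall>p. f differentiable (at p)) \<and> (\<forall>v. Ck m (\<lambda>p. frechet_derivative f (at p) v))"

text \<open>
  Elements of \<open>C\<^sub>c\<^sup>\<infinity>([0,\<infinity>) \<times> \<real>)\<close> are restrictions of smooth compactly supported functions on
  the whole plane; they need not vanish at \<open>t = 0\<close>, and their sign matters only for \<open>t \<ge> 0\<close>.
\<close>

definition test_functions :: "(real \<times> real \<Rightarrow> real) set" where
  "test_functions = {\<phi>. (\<forall>m. Ck m \<phi>) \<and> compact (closure {p. \<phi> p \<noteq> 0}) \<and> (\<forall>t\<ge>0. \<forall>x. 0 \<le> \<phi> (t, x))}"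

definition Linf :: "'a measure \<Rightarrow> ('a \<Rightarrow> real) set" where
  "Linf M = {f \<in> borel_measurable M. \<exists>C. AE p in M. \<bar>f p\<bar> \<le> C}"

text \<open>Continuity of \<open>t \<mapsto> u t\<close> from \<open>[0,T]\<close> into \<open>L\<^sup>1\<^sub>l\<^sub>o\<^sub>c(\<real>)\<close>.\<close>

definition C_L1loc :: "real \<Rightarrow> (real \<Rightarrow> real \<Rightarrow> real) \<Rightarrow> bool" where
  "C_L1loc T u \<longleftrightarrow> (\<forall>K. compact K \<longrightarrow>
     (\<forall>t\<in>{0..T}. u t absolutely_integrable_on K) \<and>
     (\<forall>s\<in>{0..T}. ((\<lambda>t. LINT x:K|lebesgue. \<bar>u t x - u s x\<bar>) \<longlongrightarrow> 0) (at s within {0..T})))"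

text \<open>
  Under the assumptions above, all \<open>k \<in> stationary_states A um up \<alpha>\<close> are measurable and bounded,
  so the integrands below are integrable and the integrals are genuine.
\<close>

definition adapted_entropy_solution ::
  "(real \<Rightarrow> real \<Rightarrow> real) \<Rightarrow> (real \<Rightarrow> real) \<Rightarrow> (real \<Rightarrow> real) \<Rightarrow> (real \<Rightarrow> real) \<Rightarrow>
   (real \<Rightarrow> real \<Rightarrow> real) \<Rightarrow> bool" where
  "adapted_entropy_solution A um up u0 u \<longleftrightarrow>
     (\<lambda>(t, x). u t x) \<in> Linf (lebesgue_on ({0<..} \<times> UNIV)) \<and>
     (\<forall>T>0. C_L1loc T u) \<and>
     (\<forall>\<alpha>\<ge>0. \<forall>k\<in>stationary_states A um up \<alpha>. \<forall>\<phi>\<in>test_functions.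
        0 \<le> (LINT (t, x):{0<..} \<times> UNIV|lebesgue.
                \<bar>u t x - k x\<bar> * deriv (\<lambda>s. \<phi> (s, x)) t +
                sgn (u t x - k x) * (A x (u t x) - \<alpha>) * deriv (\<lambda>y. \<phi> (t, y)) x)
            + (LINT x|lebesgue. \<bar>u0 x - k x\<bar> * \<phi> (0, x)))"


section \<open>The functional \<open>\<Lambda>\<close>\<close>

definition \<Delta>w ::
  "(real \<Rightarrow> real \<Rightarrow> real) \<Rightarrow> (real \<Rightarrow> real) \<Rightarrow> (real \<Rightarrow> real) \<Rightarrow> (real \<Rightarrow> real) \<Rightarrow> real \<Rightarrow> real \<Rightarrow> real" where
  "\<Delta>w A um up b x y =
     (if A x = A y then \<bar>b x - b y\<bar> else \<bar>b x - uM um up x\<bar> + \<bar>b y - uM um up y\<bar>)"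

definition \<Lambda> ::
  "(real \<Rightarrow> real \<Rightarrow> real) \<Rightarrow> (real \<Rightarrow> real) \<Rightarrow> (real \<Rightarrow> real) \<Rightarrow> (real \<Rightarrow> real) \<Rightarrow> ereal" where
  "\<Lambda> A um up b = (SUP (n, x) \<in> chains. ereal (\<Sum>j=1..n. \<Delta>w A um up b (x j) (x (Suc j))))"

end

theory Submission
  imports Defs
begin

text \<open>
  For \<open>A(x,u) = c(x) |u| + max(0, |u| - 1)\<close> the equation is a linear transport equation as long as
  \<open>0 \<le> u \<le> 1\<close>, and \<open>c u\<close> is constant along the characteristics \<open>x' = c(x)\<close>. A positive
  coefficient \<open>c = \<rho>\<^sup>2 (2 + cos (\<pi>/\<rho>))\<close>, a Lipschitz function of a bounded nondecreasing \<open>\<rho>\<close>, has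
  finite variation, while \<open>1/c\<close> oscillates strongly where \<open>\<rho>\<close> is small. The profile \<open>\<rho>\<close> is
  constant on the intervals \<open>[-8m-6, -8m]\<close> and doubles, from \<open>2\<^sup>-\<^sup>m\<^sup>-\<^sup>1\<close> to \<open>2\<^sup>-\<^sup>m\<close>, within the
  distance \<open>4\<^sup>-\<^sup>m\<^sup>-\<^sup>1\<close> to the right of \<open>-8m\<close>, so that \<open>1/\<rho>\<close> crosses about \<open>2\<^sup>m\<close> integers there. The datum equals
  \<open>h\<^sub>m = (2/3)\<^sup>m/9\<close> on these intervals and \<open>0\<close> elsewhere; since \<open>\<Sum> h\<^sub>m < \<infinity>\<close> and the flux
  does not vary inside an interval, \<open>\<Lambda>\<close> is finite. At time 1 the wave has filled the \<open>m\<close>-th transition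
  zone with the stationary state \<open>const/c\<close>, whose variation is of order \<open>2\<^sup>m h\<^sub>m\<close>, which is unbounded.

  That every adapted entropy solution does so needs no uniqueness theorem: \<open>|u - k|\<close>, with the
  stationary state \<open>k\<close> equal to the datum behind the front, is transported with a speed between
  \<open>4\<^sup>-\<^sup>m\<^sup>-\<^sup>1\<close> and \<open>4\<close> once \<open>u \<ge> 0\<close> is known, hence vanishes on a domain of dependence.
\<close>

section \<open>Suprema over chains of points\<close>

text \<open>The increments of a bounded potential \<open>V\<close> telescope along a chain. The
  increment \<open>F\<close> is kept arbitrary because both \<open>TV\<close> and
  \<open>\<Lambda>\<close> are suprema of this kind.\<close>

lemma chain_sum_le:
  assumes step: "\<And>x y. x < y \<Longrightarrow> F x y \<le> V y - V x"
    and bounds: "\<And>x. 0 \<le> V x" "\<And>x. V x \<le> (B::real)"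
  shows "(SUP (n, x) \<in> chains. ereal (\<Sum>j=1..n. F (x j) (x (Suc j)))) \<le> ereal B"
proof (rule SUP_least, clarify)
  fix n x assume "(n, x) \<in> chains"
  then have mono: "strict_mono_on {1..Suc n} x" by (auto simp: chains_def)
  have "(\<Sum>j=1..n. F (x j) (x (Suc j))) \<le> (\<Sum>j=1..n. V (x (Suc j)) - V (x j))"
    by (intro sum_mono step) (auto intro!: strict_mono_onD[OF mono])
  also have "\<dots> = V (x (Suc n)) - V (x 1)"
    by (induction n) auto
  also have "\<dots> \<le> B" using bounds[of "x 1"] bounds[of "x (Suc n)"] by linarith
  finally show "ereal (\<Sum>j=1..n. F (x j) (x (Suc j))) \<le> ereal B" by simp
qed

lemma bounded_mono_BV:
  assumes "mono V" "\<And>x. 0 \<le> V x" "\<And>x. V x \<le> (B::real)"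
  shows "V \<in> BV"
proof -
  have "TV V \<le> ereal B"
    unfolding TV_def
    by (rule chain_sum_le[where V = V]) (use assms in \<open>auto dest: monoD[of V, OF _ less_imp_le]\<close>)
  then show ?thesis unfolding BV_def using order_le_less_trans[of "TV V" "ereal B" \<infinity>] by auto
qed

section \<open>Smooth bump functions\<close>

text \<open>Needed for the product rule in \<open>Ck_mult\<close>, where the undifferentiated
  factors reappear one order lower.\<close>

lemma Ck_Suc_imp: "Ck (Suc m) f \<Longrightarrow> Ck m f"
proof (induction m arbitrary: f)
  case 0
  then show ?case
    by (auto intro!: differentiable_imp_continuous_on simp: differentiable_on_def intro: differentiable_at_withinI)
next
  case (Suc m)
  then show ?case by (metis Ck.simps(2))
qed

lemma Ck_const: "Ck m (\<lambda>_. a)"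
  by (induction m arbitrary: a) auto

lemma Ck_add: "Ck m f \<Longrightarrow> Ck m g \<Longrightarrow> Ck m (\<lambda>p. f p + g p)"
proof (induction m arbitrary: f g)
  case 0
  then show ?case by (auto intro: continuous_on_add)
next
  case (Suc m)
  have "frechet_derivative (\<lambda>p. f p + g p) (at p) =
      (\<lambda>v. frechet_derivative f (at p) v + frechet_derivative g (at p) v)" for p
    using Suc.prems by (intro frechet_derivative_at[symmetric] has_derivative_add)
      (auto simp: frechet_derivative_works[symmetric])
  with Suc show ?case by (auto intro: differentiable_add)
qed

lemma Ck_mult: "Ck m f \<Longrightarrow> Ck m g \<Longrightarrow> Ck m (\<lambda>p. f p * g p)"
proof (induction m arbitrary: f g)
  case 0
  then show ?case by (auto intro: continuous_on_mult)
next
  case (Suc m)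
  have "frechet_derivative (\<lambda>p. f p * g p) (at p) =
      (\<lambda>v. f p * frechet_derivative g (at p) v + frechet_derivative f (at p) v * g p)" for p
    using Suc.prems by (intro frechet_derivative_at[symmetric] has_derivative_mult)
      (auto simp: frechet_derivative_works[symmetric])
  moreover have "Ck m f" "Ck m g" using Suc.prems Ck_Suc_imp by blast+
  ultimately show ?case using Suc by (auto intro!: differentiable_mult Ck_add)
qed

text \<open>\<open>bump 0\<close> is the classical smooth function exp(-1/x) extended by 0. The
  powers of 1/x are carried along so that derivatives of members of the family are linear
  combinations of members.\<close>

definition bump :: "nat \<Rightarrow> real \<Rightarrow> real" where
  "bump n x = (if x \<le> 0 then 0 else exp (- 1 / x) / x ^ n)"

lemma bump_nonneg: "0 \<le> bump n x" by (simp add: bump_def)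

lemma bump_pos: "0 < x \<Longrightarrow> 0 < bump n x" by (simp add: bump_def)

lemma bump_nonpos: "x \<le> 0 \<Longrightarrow> bump n x = 0" by (simp add: bump_def)

text \<open>With y = 1/x this is the decay of y^n / exp y at infinity; from the left the function is
  constantly 0.\<close>

lemma bump_tendsto_0: "(bump n \<longlongrightarrow> 0) (at 0)"
proof -
  have "((\<lambda>x::real. (inverse x) ^ n / exp (inverse x)) \<longlongrightarrow> 0) (at_right 0)"
    by (rule filterlim_compose[OF tendsto_power_div_exp_0 filterlim_inverse_at_top_right])
  moreover have "\<forall>\<^sub>F x in at_right 0. (inverse x) ^ n / exp (inverse x) = bump n x"
    by (rule eventually_mono[OF eventually_at_right_less[of 0]])
      (auto simp: bump_def field_simps exp_minus power_inverse)
  ultimately have "(bump n \<longlongrightarrow> 0) (at_right 0)"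
    by (rule Lim_transform_eventually)
  moreover have "(bump n \<longlongrightarrow> 0) (at_left 0)"
    by (rule Lim_transform_eventually[OF tendsto_const])
      (auto simp: eventually_at_left_field bump_def intro!: exI[of _ "-1"])
  ultimately show ?thesis by (simp add: filterlim_at_split)
qed

lemma bump_has_derivative:
  "(bump n has_real_derivative bump (n + 2) x - real n * bump (n + 1) x) (at x)"
proof -
  consider "x < 0" | "x = 0" | "0 < x" by linarith
  then show ?thesis
  proof cases
    case 1
    have "((\<lambda>_. 0) has_real_derivative 0) (at x)" by simp
    then have "(bump n has_real_derivative 0) (at x)"
      by (rule has_field_derivative_transform_within_open[of _ _ _ "{..<0}"])
        (use 1 in \<open>auto simp: bump_def\<close>)
    with 1 show ?thesis by (simp add: bump_def)
  next
    case 2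
    \<comment> \<open>The difference quotient of \<open>bump n\<close> at 0 is
      \<open>bump (n + 1)\<close>, which tends to 0.\<close>
    have "(bump n has_real_derivative 0) (at 0)"
      using bump_tendsto_0[of "n + 1"] unfolding DERIV_def
      by (rule Lim_transform_eventually) (auto simp: bump_def)
    with 2 show ?thesis by (simp add: bump_def)
  next
    case 3
    have "((\<lambda>x. exp (- 1 / x) / x ^ n) has_real_derivative
        exp (- 1 / x) / x ^ (n + 2) - real n * (exp (- 1 / x) / x ^ (n + 1))) (at x)"
    proof (cases n)
      case (Suc k)
      \<comment> \<open>Reconciles the truncated exponent \<open>k - Suc 0\<close> of the power rule
        with \<open>k\<close>, including the case k = 0.\<close>
      have "real k * x ^ k = real k * (x * x ^ (k - Suc 0))" by (cases k) auto
      then show ?thesis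
        using 3 Suc by (auto intro!: derivative_eq_intros simp: field_simps power2_eq_square)
    qed (use 3 in \<open>auto intro!: derivative_eq_intros simp: power2_eq_square\<close>)
    then have "(bump n has_real_derivative
        exp (- 1 / x) / x ^ (n + 2) - real n * (exp (- 1 / x) / x ^ (n + 1))) (at x)"
      by (rule has_field_derivative_transform_within_open[of _ _ _ "{0<..}"])
        (use 3 in \<open>auto simp: bump_def\<close>)
    with 3 show ?thesis by (simp add: bump_def)
  qed
qed

lemma bump_0_has_derivative [derivative_intros]:
  "(f has_real_derivative f') (at x) \<Longrightarrow>
    ((\<lambda>x. bump 0 (f x)) has_real_derivative bump 2 (f x) * f') (at x)"
  using DERIV_chain2[OF bump_has_derivative[of 0]] by (auto simp: numeral_2_eq_2)

text \<open>Induction for all \<open>n\<close> at once, since differentiation shifts the index; the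
  affine argument contributes only the constant factor \<open>l v\<close>.\<close>

lemma Ck_bump:
  assumes "bounded_linear l"
  shows "Ck m (\<lambda>p. bump n (l p + d))"
proof (induction m arbitrary: n)
  case 0
  have "continuous_on UNIV (bump n)"
    using bump_has_derivative DERIV_isCont by (metis continuous_at_imp_continuous_on)
  moreover have "continuous_on UNIV (\<lambda>p. l p + d)"
    by (intro continuous_on_add linear_continuous_on assms continuous_on_const)
  ultimately show ?case
    using continuous_on_compose2[of UNIV "bump n" UNIV "\<lambda>p. l p + d"] by simp
next
  case (Suc m)
  have D: "((\<lambda>p. bump n (l p + d)) has_derivative
      (\<lambda>v. (bump (n + 2) (l p + d) - real n * bump (n + 1) (l p + d)) * l v)) (at p)" for p
  proof -
    have "((\<lambda>p. l p + d) has_derivative l) (at p)"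
      using bounded_linear_imp_has_derivative[OF assms] has_derivative_add_const by blast
    from has_derivative_compose[OF this bump_has_derivative[of n "l p + d", unfolded has_field_derivative_def]]
    show ?thesis by simp
  qed
  have "Ck m (\<lambda>p. (bump (n + 2) (l p + d) + (- real n) * bump (n + 1) (l p + d)) * l v)" for v
    by (intro Ck_mult Ck_add Ck_const Suc)
  with D show ?case
    by (auto simp: frechet_derivative_at[OF D, symmetric] differentiable_def)
qed

section \<open>Test functions\<close>

text \<open>Translates the Frechet formulation into what the integral computations use: continuous
  partial derivatives, a single radius \<open>R\<close> beyond which everything vanishes, and a
  single bound \<open>M\<close>.\<close>

lemma test_function_partials:
  assumes "\<phi> \<in> test_functions"
  obtains pt px :: "real \<times> real \<Rightarrow> real" and R M :: real where
    "continuous_on UNIV \<phi>" "continuous_on UNIV pt" "continuous_on UNIV px"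
    "\<And>p. (\<phi> has_derivative (\<lambda>(h, k). h * pt p + k * px p)) (at p)"
    "\<And>t x. deriv (\<lambda>s. \<phi> (s, x)) t = pt (t, x)"
    "\<And>t x. deriv (\<lambda>y. \<phi> (t, y)) x = px (t, x)"
    "\<And>t x. R \<le> \<bar>t\<bar> \<or> R \<le> \<bar>x\<bar> \<Longrightarrow> \<phi> (t, x) = 0 \<and> pt (t, x) = 0 \<and> px (t, x) = 0"
    "\<And>p. \<bar>\<phi> p\<bar> \<le> M \<and> \<bar>pt p\<bar> \<le> M \<and> \<bar>px p\<bar> \<le> M" "0 < R"
proof -
  define D where "D p = frechet_derivative \<phi> (at p)" for p
  define pt px where "pt p = D p (1, 0)" and "px p = D p (0, 1)" for p
  have "Ck 1 \<phi>" and cpt: "compact (closure {p. \<phi> p \<noteq> 0})"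
    using assms by (auto simp: test_functions_def)
  then have diff: "\<phi> differentiable (at p)" and cont: "continuous_on UNIV (\<lambda>p. D p v)" for p v
    unfolding D_def One_nat_def Ck.simps by blast+
  have D: "(\<phi> has_derivative D p) (at p)" for p
    using diff by (simp add: D_def frechet_derivative_works)
  have Deq: "D p = (\<lambda>(h, k). h * pt p + k * px p)" for p
  proof
    fix v :: "real \<times> real"
    have v: "v = fst v *\<^sub>R (1, 0) + snd v *\<^sub>R (0, 1)" by (simp add: prod_eq_iff)
    have "D p v = fst v *\<^sub>R D p (1, 0) + snd v *\<^sub>R D p (0, 1)"
      using has_derivative_linear[OF D[of p]]
      by (subst v) (simp only: linear_add linear_scale real_scaleR_def)
    then show "D p v = (case v of (h, k) \<Rightarrow> h * pt p + k * px p)"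
      by (simp add: case_prod_beta pt_def px_def)
  qed
  have c0: "continuous_on UNIV \<phi>"
    using diff by (auto intro!: differentiable_imp_continuous_on simp: differentiable_on_def intro: differentiable_at_withinI)
  have c1: "continuous_on UNIV pt" "continuous_on UNIV px"
    unfolding pt_def px_def by (rule cont)+
  define S where "S = closure {p. \<phi> p \<noteq> 0}"
  obtain R where R: "0 < R" "\<And>p. p \<in> S \<Longrightarrow> norm p < R"
    using bounded_pos_less[THEN iffD1, OF compact_imp_bounded[OF cpt]] unfolding S_def by blast
  have S: "closed S" by (simp add: S_def)
  have off: "\<phi> p = 0" if "p \<notin> S" for p
    using that subsetD[OF closure_subset, of p "{p. \<phi> p \<noteq> 0}"] unfolding S_def mem_Collect_eq by argo
  \<comment> \<open>The complement of the support is open, so the function is locally 0 there and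
    its derivative vanishes too.\<close>
  have zero: "\<phi> p = 0 \<and> pt p = 0 \<and> px p = 0" if "p \<notin> S" for p
  proof -
    have "((\<lambda>_. 0) has_derivative D p) (at p)"
      by (rule has_derivative_transform_within_open[OF D, of "- S"])
        (use that S off in \<open>simp_all add: open_Compl\<close>)
    then have "D p = (\<lambda>_. 0)" by (rule has_derivative_unique[OF _ has_derivative_const])
    then show ?thesis using off[OF that] by (simp add: pt_def px_def)
  qed
  have far: "\<phi> (t, x) = 0 \<and> pt (t, x) = 0 \<and> px (t, x) = 0" if "R \<le> \<bar>t\<bar> \<or> R \<le> \<bar>x\<bar>" for t x
  proof -
    have "\<bar>t\<bar> \<le> norm (t, x)" "\<bar>x\<bar> \<le> norm (t, x)"
      using norm_fst_le[of t x] norm_snd_le[of x t] by auto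
    then show ?thesis using R(2)[of "(t, x)"] zero[of "(t, x)"] that by fastforce
  qed
  have bd: "\<exists>M. \<forall>p. \<bar>f p\<bar> \<le> M"
    if "continuous_on UNIV f" "\<And>p. p \<notin> S \<Longrightarrow> f p = 0" for f :: "real \<times> real \<Rightarrow> real"
  proof -
    have "bounded (f ` S)"
      using that(1) cpt[folded S_def] by (intro compact_imp_bounded compact_continuous_image) (auto intro: continuous_on_subset)
    then obtain M where "0 < M" "\<And>p. p \<in> S \<Longrightarrow> \<bar>f p\<bar> \<le> M"
      unfolding bounded_pos by auto
    then have "\<bar>f p\<bar> \<le> M" for p
      using that(2)[of p] by (cases "p \<in> S") auto
    then show ?thesis by blast
  qed
  obtain M0 M1 M2 where M: "\<And>p. \<bar>\<phi> p\<bar> \<le> M0" "\<And>p. \<bar>pt p\<bar> \<le> M1" "\<And>p. \<bar>px p\<bar> \<le> M2"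
  proof -
    have "\<exists>M. \<forall>p. \<bar>\<phi> p\<bar> \<le> M" "\<exists>M. \<forall>p. \<bar>pt p\<bar> \<le> M" "\<exists>M. \<forall>p. \<bar>px p\<bar> \<le> M"
      by (rule bd[OF c0] bd[OF c1(1)] bd[OF c1(2)]; use zero in blast)+
    then show ?thesis using that by blast
  qed
  have bound: "\<bar>\<phi> p\<bar> \<le> max M0 (max M1 M2) \<and> \<bar>pt p\<bar> \<le> max M0 (max M1 M2) \<and> \<bar>px p\<bar> \<le> max M0 (max M1 M2)" for p
    using M[of p] by linarith
  have dt: "deriv (\<lambda>s. \<phi> (s, x)) t = pt (t, x)" for t x
  proof -
    have "((\<lambda>s. (s, x)) has_derivative (\<lambda>h. (h, 0))) (at t)"
      by (auto intro!: derivative_eq_intros)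
    from has_derivative_compose[OF this D[of "(t, x)"]]
    have "((\<lambda>s. \<phi> (s, x)) has_real_derivative pt (t, x)) (at t)"
      by (auto simp: has_field_derivative_def Deq mult.commute fun_eq_iff elim: has_derivative_eq_rhs)
    then show ?thesis by (rule DERIV_imp_deriv)
  qed
  have dx: "deriv (\<lambda>y. \<phi> (t, y)) x = px (t, x)" for t x
  proof -
    have "((\<lambda>y. (t, y)) has_derivative (\<lambda>h. (0, h))) (at x)"
      by (auto intro!: derivative_eq_intros)
    from has_derivative_compose[OF this D[of "(t, x)"]]
    have "((\<lambda>y. \<phi> (t, y)) has_real_derivative px (t, x)) (at x)"
      by (auto simp: has_field_derivative_def Deq mult.commute fun_eq_iff elim: has_derivative_eq_rhs)
    then show ?thesis by (rule DERIV_imp_deriv)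
  qed
  show ?thesis
    by (rule that[OF c0 c1 D[unfolded Deq] dt dx far bound R(1)])
qed

text \<open>Compact support cuts the half line down to an interval [a,b] with b beyond the support,
  where the fundamental theorem applies and only the endpoint \<open>a\<close> contributes.\<close>

lemma half_line_FTC:
  fixes F f :: "real \<Rightarrow> real"
  assumes "\<And>t. (F has_real_derivative f t) (at t)" "\<And>t. isCont f t"
    and "\<And>t. R \<le> \<bar>t\<bar> \<Longrightarrow> F t = 0" "\<And>t. R \<le> \<bar>t\<bar> \<Longrightarrow> f t = 0"
  shows "(LINT t|lborel. indicator {a<..} t * f t) = - F a"
proof -
  define b where "b = \<bar>a\<bar> + \<bar>R\<bar>"
  have "(LINT t|lborel. indicator {a<..} t * f t) = (LINT t|lborel. f t * indicator {a..b} t)"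
  proof (rule integral_cong_AE)
    have "f \<in> borel_measurable borel"
      using assms(2) by (intro borel_measurable_continuous_onI) (auto intro: continuous_at_imp_continuous_on)
    then show "(\<lambda>t. indicator {a<..} t * f t) \<in> borel_measurable lborel"
      and "(\<lambda>t. f t * indicator {a..b} t) \<in> borel_measurable lborel" by auto
    show "AE t in lborel. indicator {a<..} t * f t = f t * indicator {a..b} t"
      using AE_lborel_singleton[of a]
    proof eventually_elim
      case (elim t)
      then show ?case using assms(4)[of t] unfolding b_def by (cases "a < t"; cases "t \<le> b") (auto simp: indicator_def b_def)
    qed
  qed
  also have "\<dots> = F b - F a"
    by (rule integral_FTC_Icc_real) (use assms b_def in auto)
  also have "F b = 0" using assms(3)[of b] b_def by simp
  finally show ?thesis by simp
qed

lemma bounded_box_integrable: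
  fixes f :: "'a::euclidean_space \<Rightarrow> real"
  assumes "f \<in> borel_measurable M" "M = lborel \<or> M = lebesgue" "bounded S"
    "AE p in M. \<bar>f p\<bar> \<le> B" "\<And>p. p \<notin> S \<Longrightarrow> f p = 0"
  shows "integrable M f"
proof -
  obtain r where r: "S \<subseteq> cball 0 r"
    using assms(3) unfolding bounded_iff by (auto simp: subset_iff)
  have fin: "emeasure M (cball 0 r) < \<infinity>"
    using assms(2) emeasure_lborel_cball_finite[of "0::'a" r] by (elim disjE) simp_all
  have cb: "cball 0 r \<in> sets M" using assms(2) by (elim disjE) simp_all
  show ?thesis
  proof (rule integrableI_bounded_set[OF cb assms(1) fin])
    show "AE p in M. p \<in> cball 0 r \<longrightarrow> norm (f p) \<le> B"
      using assms(4) by (rule eventually_mono) simp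
    show "AE p in M. p \<notin> cball 0 r \<longrightarrow> f p = 0"
      using assms(5) r by (intro AE_I2) blast
  qed
qed

text \<open>Passes from \<open>lebesgue\<close> to \<open>lborel\<close>, which is a product
  measure, so that Fubini's theorem can be applied.\<close>

lemma set_lborel_half_plane:
  fixes f :: "real \<times> real \<Rightarrow> real"
  assumes "f \<in> borel_measurable borel"
  shows "(LINT p:{0<..} \<times> UNIV|lebesgue. f p) = (LINT p|lborel. indicator {0<..} (fst p) * f p)"
proof -
  have "(LINT p:{0<..} \<times> UNIV|lebesgue. f p) = (LINT p|lebesgue. indicator {0<..} (fst p) * f p)"
    unfolding set_lebesgue_integral_def by (intro Bochner_Integration.integral_cong) (auto simp: indicator_def)
  also have "\<dots> = (LINT p|lborel. indicator {0<..} (fst p) * f p)"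
  proof (rule integral_completion)
    have [measurable]: "fst \<in> borel_measurable (borel :: (real \<times> real) measure)"
      by (intro borel_measurable_continuous_onI continuous_intros)
    show "(\<lambda>p. indicator {0<..} (fst p) * f p) \<in> borel_measurable lborel"
      using assms by measurable
  qed
  finally show ?thesis .
qed

text \<open>By Fubini the t-integral may be taken first; for fixed x it equals minus the value of
  the test function at time 0. This handles the time-independent part of the densities in
  \<open>transport_balance\<close>.\<close>

lemma test_function_stationary:
  assumes "\<phi> \<in> test_functions" and [measurable]: "\<rho> \<in> borel_measurable borel" and loc: "\<And>R. \<exists>B. \<forall>x\<in>{-R..R}. \<bar>\<rho> x\<bar> \<le> B"
  shows "(LINT (t, x):{0<..} \<times> UNIV|lebesgue. \<rho> x * deriv (\<lambda>s. \<phi> (s, x)) t) + (LINT x|lebesgue. \<rho> x * \<phi> (0, x)) = 0"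
proof -
  obtain pt px R M where cont: "continuous_on UNIV \<phi>" "continuous_on UNIV pt" "continuous_on UNIV px"
    and D: "\<And>p. (\<phi> has_derivative (\<lambda>(h, k). h * pt p + k * px p)) (at p)"
    and dt: "\<And>t x. deriv (\<lambda>s. \<phi> (s, x)) t = pt (t, x)"
    and dx: "\<And>t x. deriv (\<lambda>y. \<phi> (t, y)) x = px (t, x)"
    and far: "\<And>t x. R \<le> \<bar>t\<bar> \<or> R \<le> \<bar>x\<bar> \<Longrightarrow> \<phi> (t, x) = 0 \<and> pt (t, x) = 0 \<and> px (t, x) = 0"
    and bd: "\<And>p. \<bar>\<phi> p\<bar> \<le> M \<and> \<bar>pt p\<bar> \<le> M \<and> \<bar>px p\<bar> \<le> M" and "0 < R"
    by (rule test_function_partials[OF assms(1)]) (rule that)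
  have [measurable]: "\<phi> \<in> borel_measurable borel" "pt \<in> borel_measurable borel"
    using cont by (auto intro: borel_measurable_continuous_onI)
  obtain B where B: "\<forall>x\<in>{-R..R}. \<bar>\<rho> x\<bar> \<le> B" using loc by blast
  define F where "F t x = indicator {0<..} t * (\<rho> x * pt (t, x))" for t x
  have [measurable]: "case_prod F \<in> borel_measurable borel"
    unfolding F_def borel_prod[symmetric] by measurable
  have "integrable lborel (case_prod F)"
  proof (rule bounded_box_integrable[where S = "{-R..R} \<times> {-R..R}" and B = "\<bar>B\<bar> * \<bar>M\<bar>"])
    show "AE p in lborel. \<bar>case_prod F p\<bar> \<le> \<bar>B\<bar> * \<bar>M\<bar>"
    proof (intro AE_I2, clarify)
      fix t x
      have "\<bar>\<rho> x\<bar> * \<bar>pt (t, x)\<bar> \<le> \<bar>B\<bar> * \<bar>M\<bar>"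
      proof (cases "R \<le> \<bar>x\<bar>")
        case False
        then have "x \<in> {-R..R}" by auto
        then have "\<bar>\<rho> x\<bar> \<le> B" using B by blast
        then show ?thesis using bd[of "(t, x)"] by (intro mult_mono) auto
      qed (simp add: far)
      then show "\<bar>F t x\<bar> \<le> \<bar>B\<bar> * \<bar>M\<bar>" by (auto simp: F_def abs_mult indicator_def)
    qed
    show "case_prod F p = 0" if "p \<notin> {-R..R} \<times> {-R..R}" for p
    proof -
      obtain t x where p: "p = (t, x)" by (cases p)
      with that have "R \<le> \<bar>t\<bar> \<or> R \<le> \<bar>x\<bar>" by auto
      then show ?thesis using far by (simp add: p F_def)
    qed
  qed (auto intro: bounded_Times)
  then have I: "integrable (lborel \<Otimes>\<^sub>M lborel) (case_prod F)" by (simp add: lborel_prod)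
  have "(LINT (t, x):{0<..} \<times> UNIV|lebesgue. \<rho> x * deriv (\<lambda>s. \<phi> (s, x)) t) = (LINT p|lborel. case_prod F p)"
  proof (subst set_lborel_half_plane)
    show "(\<lambda>(t, x). \<rho> x * deriv (\<lambda>s. \<phi> (s, x)) t) \<in> borel_measurable borel"
      unfolding dt borel_prod[symmetric] by measurable
  qed (auto simp: dt F_def intro!: Bochner_Integration.integral_cong)
  also have "\<dots> = (LINT x|lborel. LINT t|lborel. F t x)"
    using lborel_pair.integral_snd[OF I] by (simp add: lborel_prod)
  also have "(\<lambda>x. LINT t|lborel. F t x) = (\<lambda>x. - (\<rho> x * \<phi> (0, x)))"
  proof
    fix x
    have "(LINT t|lborel. indicator {0<..} t * pt (t, x)) = - \<phi> (0, x)"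
    proof (rule half_line_FTC[where F = "\<lambda>t. \<phi> (t, x)" and R = R])
      fix t :: real
      have "((\<lambda>s. (s, x)) has_derivative (\<lambda>h. (h, 0))) (at t)"
        by (auto intro!: derivative_eq_intros)
      from has_derivative_compose[OF this D[of "(t, x)"]]
      show "((\<lambda>s. \<phi> (s, x)) has_real_derivative pt (t, x)) (at t)"
        by (auto simp: has_field_derivative_def mult.commute fun_eq_iff elim: has_derivative_eq_rhs)
      have "continuous_on UNIV (\<lambda>t. pt (t, x))"
        by (rule continuous_on_compose2[OF cont(2)]) (auto intro!: continuous_intros)
      then show "isCont (\<lambda>t. pt (t, x)) t" by (simp add: continuous_on_eq_continuous_at)
    qed (use far in auto)
    moreover have "F t x = \<rho> x * (indicator {0<..} t * pt (t, x))" for t by (simp add: F_def)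
    ultimately show "(LINT t|lborel. F t x) = - (\<rho> x * \<phi> (0, x))" by simp
  qed
  also have "(LINT x|lborel. - (\<rho> x * \<phi> (0, x))) = - (LINT x|lebesgue. \<rho> x * \<phi> (0, x))"
    by (subst integral_completion) simp_all
  finally show ?thesis by simp
qed

section \<open>Transport along characteristics\<close>

text \<open>\<open>Y\<close> is the travel time along x' = c(x), so the characteristic through x at
  time t carries the label \<open>Y x - t\<close>, and \<open>X\<close> maps a label to its foot at
  time 0. The law \<open>Y (X z) = z\<close> encodes surjectivity of \<open>Y\<close>; strict
  monotonicity then makes \<open>X\<close> a two-sided inverse.\<close>

locale characteristics =
  fixes c Y X :: "real \<Rightarrow> real"
  assumes c_cont: "continuous_on UNIV c" and c_pos: "0 < c x"
    and Y_deriv: "(Y has_real_derivative 1 / c x) (at x)"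
    and YX: "Y (X z) = z"
begin

lemma c_measurable [measurable]: "c \<in> borel_measurable borel"
  using c_cont by (rule borel_measurable_continuous_onI)

lemma Y_cont: "continuous_on UNIV Y"
  using Y_deriv by (meson DERIV_continuous_on has_field_derivative_at_within)

lemma Y_measurable [measurable]: "Y \<in> borel_measurable borel"
  using Y_cont by (rule borel_measurable_continuous_onI)

lemma Y_less: "x < y \<Longrightarrow> Y x < Y y"
  by (rule DERIV_pos_imp_increasing) (use Y_deriv c_pos in \<open>auto intro!: exI[of _ "1 / c _"]\<close>)

lemma Y_less_iff: "Y x < Y y \<longleftrightarrow> x < y"
  using Y_less by (metis less_irrefl less_linear order_less_trans)

lemma XY: "X (Y x) = x"
  using Y_less_iff YX by (metis less_irrefl linorder_neqE)

lemma Y_le_iff: "Y x \<le> Y y \<longleftrightarrow> x \<le> y"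
  using Y_less_iff[of y x] by linarith

lemma less_Y_iff: "z < Y x \<longleftrightarrow> X z < x" and Y_less_iff': "Y x < z \<longleftrightarrow> x < X z"
  using Y_less_iff YX by metis+

lemma mono_X: "mono X"
  by (rule monoI) (metis YX Y_le_iff)

lemma X_measurable [measurable]: "X \<in> borel_measurable borel"
  using mono_X by (rule borel_measurable_mono)

lemma X_cont: "isCont X z"
proof -
  have "isCont X (Y (X z))"
    by (rule isCont_inverse_function[where d = 1])
      (use XY Y_cont in \<open>auto simp: continuous_on_eq_continuous_at\<close>)
  then show ?thesis by (simp add: YX)
qed

text \<open>The change of variables z = Y x. It suffices to compare open intervals: the preimage of
  (l,u) is (X l, X u), and 1/c integrates over it to Y (X u) - Y (X l) = u - l.\<close>

lemma lborel_pushforward: "lborel = distr (density lborel (\<lambda>x. ennreal (1 / c x))) borel Y"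
proof (rule lborel_eqI)
  fix l u :: real
  assume "\<And>b. b \<in> Basis \<Longrightarrow> l \<bullet> b \<le> u \<bullet> b"
  then have lu: "l \<le> u" by simp
  have vim: "Y -` {l<..<u} = {X l<..<X u}"
    using less_Y_iff Y_less_iff' by auto
  have "emeasure (distr (density lborel (\<lambda>x. ennreal (1 / c x))) borel Y) (box l u)
      = emeasure (density lborel (\<lambda>x. ennreal (1 / c x))) {X l<..<X u}"
    by (subst emeasure_distr) (auto simp: vim box_real)
  also have "\<dots> = (\<integral>\<^sup>+x. ennreal (1 / c x) * indicator {X l<..<X u} x \<partial>lborel)"
    by (subst emeasure_density) auto
  also have "\<dots> = (\<integral>\<^sup>+x. ennreal (1 / c x) * indicator {X l..X u} x \<partial>lborel)"
    using AE_lborel_singleton[of "X l"] AE_lborel_singleton[of "X u"]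
    by (intro nn_integral_cong_AE) (auto elim!: eventually_elim2 simp: indicator_def)
  also have "\<dots> = ennreal (Y (X u) - Y (X l))"
    using mono_X[THEN monoD, OF lu] c_pos Y_deriv
    by (intro nn_integral_FTC_Icc) (auto intro: less_imp_le has_field_derivative_at_within)
  finally show "emeasure (distr (density lborel (\<lambda>x. ennreal (1 / c x))) borel Y) (box l u) = (\<Prod>b\<in>Basis. (u - l) \<bullet> b)"
    by (simp add: YX)
qed simp

lemma integral_pushforward:
  fixes f :: "real \<Rightarrow> real"
  assumes [measurable]: "f \<in> borel_measurable borel"
  shows "(LINT z|lborel. f z) = (LINT x|lborel. f (Y x) / c x)"
proof -
  have "(LINT z|lborel. f z) = (LINT x|density lborel (\<lambda>x. ennreal (1 / c x)). f (Y x))"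
    by (subst lborel_pushforward, subst integral_distr) auto
  also have "\<dots> = (LINT x|lborel. f (Y x) / c x)"
    using c_pos by (subst integral_density) (auto intro: less_imp_le)
  finally show ?thesis .
qed

text \<open>In the coordinates (z,x) with z = Y x - t, the expression phi_t / c + phi_x is the total
  x-derivative of phi(Y x - z, x) at fixed label z. Integrating it over x > X z leaves -phi(0, X z),
  and substituting z = Y x turns this into the initial term.\<close>

lemma transport_identity:
  assumes "\<phi> \<in> test_functions" and [measurable]: "Q \<in> borel_measurable borel" and Q: "\<And>z. \<bar>Q z\<bar> \<le> B"
  shows "(LINT (t, x):{0<..} \<times> UNIV|lebesgue.
      Q (Y x - t) * (deriv (\<lambda>s. \<phi> (s, x)) t / c x + deriv (\<lambda>y. \<phi> (t, y)) x)) +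
    (LINT x|lebesgue. Q (Y x) / c x * \<phi> (0, x)) = 0"
proof -
  obtain pt px R M where cont: "continuous_on UNIV \<phi>" "continuous_on UNIV pt" "continuous_on UNIV px"
    and D: "\<And>p. (\<phi> has_derivative (\<lambda>(h, k). h * pt p + k * px p)) (at p)"
    and dt: "\<And>t x. deriv (\<lambda>s. \<phi> (s, x)) t = pt (t, x)"
    and dx: "\<And>t x. deriv (\<lambda>y. \<phi> (t, y)) x = px (t, x)"
    and far: "\<And>t x. R \<le> \<bar>t\<bar> \<or> R \<le> \<bar>x\<bar> \<Longrightarrow> \<phi> (t, x) = 0 \<and> pt (t, x) = 0 \<and> px (t, x) = 0"
    and bd: "\<And>p. \<bar>\<phi> p\<bar> \<le> M \<and> \<bar>pt p\<bar> \<le> M \<and> \<bar>px p\<bar> \<le> M" and "0 < R"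
    by (rule test_function_partials[OF assms(1)]) (rule that)
  have [measurable]: "\<phi> \<in> borel_measurable borel" "pt \<in> borel_measurable borel" "px \<in> borel_measurable borel"
    using cont by (auto intro: borel_measurable_continuous_onI)
  define g where "g t x = pt (t, x) / c x + px (t, x)" for t x
  have g_meas [measurable]: "case_prod g \<in> borel_measurable borel"
    unfolding g_def borel_prod[symmetric] by measurable
  have g_far: "g t x = 0" if "R \<le> \<bar>t\<bar> \<or> R \<le> \<bar>x\<bar>" for t x
    using far[OF that] by (simp add: g_def)
  obtain G where G: "\<And>t x. \<bar>g t x\<bar> \<le> G"
  proof -
    \<comment> \<open>There is no global positive lower bound for \<open>c\<close>, but a minimum
      over the support suffices to bound 1/c there.\<close>
    have "\<exists>x0\<in>{-R..R}. \<forall>x\<in>{-R..R}. c x0 \<le> c x"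
      using \<open>0 < R\<close> by (intro continuous_attains_inf continuous_on_subset[OF c_cont]) auto
    then obtain x0 where x0: "\<And>x. x \<in> {-R..R} \<Longrightarrow> c x0 \<le> c x" by blast
    have "\<bar>g t x\<bar> \<le> M / c x0 + M" for t x
    proof (cases "R \<le> \<bar>x\<bar>")
      case True
      then have "g t x = 0" using g_far by blast
      moreover have "0 \<le> M" using bd[of "(t, x)"] by linarith
      ultimately show ?thesis using c_pos[of x0] by simp
    next
      case False
      then have "x \<in> {-R..R}" by auto
      then have "c x0 \<le> c x" by (rule x0)
      then have "\<bar>pt (t, x)\<bar> / c x \<le> M / c x0"
        using bd[of "(t, x)"] c_pos[of x0] by (intro frac_le) auto
      then have "\<bar>pt (t, x) / c x\<bar> \<le> M / c x0" using c_pos[of x] by (simp add: abs_divide)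
      then show ?thesis using bd[of "(t, x)"] unfolding g_def by linarith
    qed
    then show ?thesis using that by blast
  qed
  \<comment> \<open>\<open>H\<close> is \<open>F\<close> expressed by label and position; the
    condition t > 0 becomes z < Y x.\<close>
  define F where "F t x = indicator {0<..} t * (Q (Y x - t) * g t x)" for t x
  define H where "H z x = (if z < Y x then Q z * g (Y x - z) x else 0)" for z x
  have [measurable]: "case_prod F \<in> borel_measurable borel" "case_prod H \<in> borel_measurable borel"
    unfolding F_def H_def g_def borel_prod[symmetric] by measurable
  have QG: "\<bar>Q z * g t x\<bar> \<le> \<bar>B\<bar> * \<bar>G\<bar>" for z t x
    unfolding abs_mult using Q[of z] G[of t x] by (intro mult_mono) auto
  have "integrable lborel (case_prod F)"
  proof (rule bounded_box_integrable[where S = "{-R..R} \<times> {-R..R}" and B = "\<bar>B\<bar> * \<bar>G\<bar>"])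
    show "AE p in lborel. \<bar>case_prod F p\<bar> \<le> \<bar>B\<bar> * \<bar>G\<bar>"
      using QG by (intro AE_I2) (auto simp: F_def indicator_def)
    show "case_prod F p = 0" if "p \<notin> {-R..R} \<times> {-R..R}" for p
    proof -
      obtain t x where p: "p = (t, x)" by (cases p)
      with that have "R \<le> \<bar>t\<bar> \<or> R \<le> \<bar>x\<bar>" by auto
      then show ?thesis using g_far by (simp add: p F_def)
    qed
  qed (auto intro: bounded_Times)
  then have IF: "integrable (lborel \<Otimes>\<^sub>M lborel) (case_prod F)" by (simp add: lborel_prod)
  have "integrable lborel (case_prod H)"
  \<comment> \<open>The label is Y x - t, so |x| <= R and |t| <= R confine it to
    [Y (-R) - R, Y R + R].\<close>
  proof (rule bounded_box_integrable[where S = "{Y (-R) - R..Y R + R} \<times> {-R..R}" and B = "\<bar>B\<bar> * \<bar>G\<bar>"])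
    show "AE p in lborel. \<bar>case_prod H p\<bar> \<le> \<bar>B\<bar> * \<bar>G\<bar>"
      using QG by (intro AE_I2) (auto simp: H_def indicator_def)
    show "case_prod H p = 0" if "p \<notin> {Y (-R) - R..Y R + R} \<times> {-R..R}" for p
    proof -
      obtain z x where p: "p = (z, x)" by (cases p)
      have "R \<le> \<bar>x\<bar> \<or> R \<le> \<bar>Y x - z\<bar>"
      proof (cases "x \<in> {-R..R}")
        case True
        then have "Y (-R) \<le> Y x" "Y x \<le> Y R" by (auto simp: Y_le_iff)
        with True that show ?thesis by (auto simp: p)
      qed auto
      then show ?thesis using g_far by (auto simp: p H_def)
    qed
  qed (auto intro: bounded_Times)
  then have IH: "integrable (lborel \<Otimes>\<^sub>M lborel) (case_prod H)" by (simp add: lborel_prod)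
  have "(LINT (t, x):{0<..} \<times> UNIV|lebesgue.
      Q (Y x - t) * (deriv (\<lambda>s. \<phi> (s, x)) t / c x + deriv (\<lambda>y. \<phi> (t, y)) x)) = (LINT p|lborel. case_prod F p)"
    unfolding dt dx g_def[symmetric]
  proof (subst set_lborel_half_plane)
    show "(\<lambda>(t, x). Q (Y x - t) * g t x) \<in> borel_measurable borel"
      unfolding g_def borel_prod[symmetric] by measurable
  qed (auto simp: F_def intro!: Bochner_Integration.integral_cong)
  also have "\<dots> = (LINT x|lborel. LINT t|lborel. F t x)"
    using lborel_pair.integral_snd[OF IF] by (simp add: lborel_prod)
  also have "(\<lambda>x. LINT t|lborel. F t x) = (\<lambda>x. LINT z|lborel. H z x)"
  proof
    fix x
    show "(LINT t|lborel. F t x) = (LINT z|lborel. H z x)"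
      by (subst lborel_integral_real_affine[where c = "-1" and t = "Y x"])
        (auto simp: F_def H_def indicator_def intro!: Bochner_Integration.integral_cong)
  qed
  also have "(LINT x|lborel. LINT z|lborel. H z x) = (LINT z|lborel. LINT x|lborel. H z x)"
    by (rule lborel_pair.Fubini_integral[OF IH])
  also have "(\<lambda>z. LINT x|lborel. H z x) = (\<lambda>z. - (Q z * \<phi> (0, X z)))"
  proof
    fix z
    have "(LINT x|lborel. indicator {X z<..} x * g (Y x - z) x) = - \<phi> (Y (X z) - z, X z)"
    proof (rule half_line_FTC[where F = "\<lambda>x. \<phi> (Y x - z, x)" and R = R])
      fix x
      have "((\<lambda>x. (Y x - z, x)) has_derivative (\<lambda>h. (h / c x, h))) (at x)"
        using Y_deriv[of x] unfolding has_field_derivative_def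
        by (auto intro!: derivative_eq_intros simp: mult.commute)
      from has_derivative_compose[OF this D[of "(Y x - z, x)"]]
      show "((\<lambda>x. \<phi> (Y x - z, x)) has_real_derivative g (Y x - z) x) (at x)"
        by (auto simp: has_field_derivative_def g_def field_simps fun_eq_iff elim!: has_derivative_eq_rhs)
      have "continuous_on UNIV (\<lambda>x. pt (Y x - z, x))" "continuous_on UNIV (\<lambda>x. px (Y x - z, x))"
        by (rule continuous_on_compose2[OF cont(2)] continuous_on_compose2[OF cont(3)];
            auto intro!: continuous_intros Y_cont)+
      then have "continuous_on UNIV (\<lambda>x. g (Y x - z) x)"
        using c_pos unfolding g_def by (intro continuous_on_add continuous_on_divide c_cont) (auto simp: less_le)
      then show "isCont (\<lambda>x. g (Y x - z) x) x" by (simp add: continuous_on_eq_continuous_at)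
    qed (use far g_far in auto)
    moreover have "H z x = Q z * (indicator {X z<..} x * g (Y x - z) x)" for x
      by (auto simp: H_def indicator_def less_Y_iff)
    ultimately show "(LINT x|lborel. H z x) = - (Q z * \<phi> (0, X z))" by (simp add: YX)
  qed
  also have "(LINT z|lborel. - (Q z * \<phi> (0, X z))) = - (LINT x|lborel. Q (Y x) * \<phi> (0, x) / c x)"
    using integral_pushforward[of "\<lambda>z. Q z * \<phi> (0, X z)"] by (simp add: XY)
  also have "(LINT x|lborel. Q (Y x) * \<phi> (0, x) / c x) = (LINT x|lebesgue. Q (Y x) / c x * \<phi> (0, x))"
    by (subst integral_completion) simp_all
  finally show ?thesis by simp
qed

end

section \<open>Domains of dependence\<close>

abbreviation half_plane :: "(real \<times> real) measure" where
  "half_plane \<equiv> lebesgue_on ({0<..} \<times> UNIV)"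

lemma half_plane_sets: "{0<..} \<times> UNIV \<in> sets (lebesgue :: (real \<times> real) measure)"
proof -
  have "open ({0<..} \<times> UNIV :: (real \<times> real) set)" by (intro open_Times) auto
  then show ?thesis by auto
qed

lemma half_plane_time_pos: "AE (t, x) in half_plane. 0 < t"
  by (rule AE_I2) (auto simp: space_restrict_space)

lemma half_plane_integral:
  fixes f :: "real \<times> real \<Rightarrow> real"
  shows "(LINT p:{0<..} \<times> UNIV|lebesgue. f p) = (LINT p|half_plane. f p)"
  using half_plane_sets by (subst integral_restrict_space) (auto simp: set_lebesgue_integral_def)

lemma borel_imp_half_plane_measurable:
  "f \<in> borel_measurable borel \<Longrightarrow> f \<in> borel_measurable half_plane"
  by (intro measurable_restrict_space1 measurable_completion) simp

lemma Linf_add: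
  assumes "f \<in> Linf M" "g \<in> Linf M"
  shows "(\<lambda>x. f x + g x) \<in> Linf M"
proof -
  obtain B B' where "AE x in M. \<bar>f x\<bar> \<le> B" "AE x in M. \<bar>g x\<bar> \<le> B'"
    using assms unfolding Linf_def by blast
  then have "AE x in M. \<bar>f x + g x\<bar> \<le> B + B'" by eventually_elim auto
  then show ?thesis using assms unfolding Linf_def by auto
qed

lemma Linf_times_integrable:
  assumes w: "w \<in> Linf half_plane" and g: "continuous_on UNIV g" "\<And>p. \<bar>g p\<bar> \<le> M"
    and far: "\<And>t x. R \<le> \<bar>t\<bar> \<or> R \<le> \<bar>x\<bar> \<Longrightarrow> g (t, x) = 0"
  shows "integrable half_plane (\<lambda>p. w p * g p)"
proof -
  let ?H = "{0<..} \<times> UNIV :: (real \<times> real) set"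
  obtain B where wm: "w \<in> borel_measurable half_plane" and B: "AE p in half_plane. \<bar>w p\<bar> \<le> B"
    using w by (auto simp: Linf_def)
  have "g \<in> borel_measurable half_plane"
    by (intro borel_imp_half_plane_measurable borel_measurable_continuous_onI g)
  with wm have m: "(\<lambda>p. w p * g p) \<in> borel_measurable half_plane" by simp
  have "integrable lebesgue (\<lambda>p. indicator ?H p *\<^sub>R (w p * g p))"
  proof (rule bounded_box_integrable[where S = "{-R..R} \<times> {-R..R}" and B = "\<bar>B\<bar> * M"])
    show "(\<lambda>p. indicator ?H p *\<^sub>R (w p * g p)) \<in> borel_measurable lebesgue"
      using m half_plane_sets by (subst (asm) borel_measurable_restrict_space_iff) auto
    have "AE p in lebesgue. p \<in> ?H \<longrightarrow> \<bar>w p\<bar> \<le> B"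
      using B half_plane_sets by (subst (asm) AE_restrict_space_iff) auto
    then show "AE p in lebesgue. \<bar>indicator ?H p *\<^sub>R (w p * g p)\<bar> \<le> \<bar>B\<bar> * M"
    proof (rule eventually_mono)
      fix p assume p: "p \<in> ?H \<longrightarrow> \<bar>w p\<bar> \<le> B"
      have "0 \<le> M" using g(2)[of p] by linarith
      moreover have "\<bar>w p * g p\<bar> \<le> \<bar>B\<bar> * M" if "p \<in> ?H"
        unfolding abs_mult using p that g(2)[of p] by (intro mult_mono) auto
      ultimately show "\<bar>indicator ?H p *\<^sub>R (w p * g p)\<bar> \<le> \<bar>B\<bar> * M"
        by (cases "p \<in> ?H") auto
    qed
    show "indicator ?H p *\<^sub>R (w p * g p) = 0" if "p \<notin> {-R..R} \<times> {-R..R}" for p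
    proof -
      obtain t x where p: "p = (t, x)" by (cases p)
      with that have "R \<le> \<bar>t\<bar> \<or> R \<le> \<bar>x\<bar>" by auto
      then show ?thesis using far by (simp add: p)
    qed
  qed (auto intro: bounded_Times)
  then show ?thesis
    using half_plane_sets by (subst integrable_restrict_space) auto
qed

text \<open>The weak form of w_t + G_x with initial value \<open>w0\<close>. A nonnegative balance
  for all test functions expresses w_t + G_x <= 0, the form taken by every entropy
  inequality.\<close>

definition balance ::
  "(real \<Rightarrow> real \<Rightarrow> real) \<Rightarrow> (real \<Rightarrow> real \<Rightarrow> real) \<Rightarrow> (real \<Rightarrow> real) \<Rightarrow> (real \<times> real \<Rightarrow> real) \<Rightarrow> real" where
  "balance w G w0 \<phi> =
    (LINT (t, x):{0<..} \<times> UNIV|lebesgue. w t x * deriv (\<lambda>s. \<phi> (s, x)) t + G t x * deriv (\<lambda>y. \<phi> (t, y)) x)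
    + (LINT x|lebesgue. w0 x * \<phi> (0, x))"

text \<open>Linearity of the integrals requires integrability, which comes from essential
  boundedness and compact support. The rule serves to add entropy inequalities for different
  stationary states.\<close>

lemma balance_add:
  assumes "\<phi> \<in> test_functions"
    and w: "case_prod w \<in> Linf half_plane" "case_prod w' \<in> Linf half_plane"
    and G: "case_prod G \<in> Linf half_plane" "case_prod G' \<in> Linf half_plane"
    and w0: "w0 \<in> Linf lebesgue" "w0' \<in> Linf lebesgue"
  shows "balance (\<lambda>t x. w t x + w' t x) (\<lambda>t x. G t x + G' t x) (\<lambda>x. w0 x + w0' x) \<phi>
    = balance w G w0 \<phi> + balance w' G' w0' \<phi>"
proof -
  obtain pt px R M where cont: "continuous_on UNIV \<phi>" "continuous_on UNIV pt" "continuous_on UNIV px"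
    and D: "\<And>p. (\<phi> has_derivative (\<lambda>(h, k). h * pt p + k * px p)) (at p)"
    and dt: "\<And>t x. deriv (\<lambda>s. \<phi> (s, x)) t = pt (t, x)"
    and dx: "\<And>t x. deriv (\<lambda>y. \<phi> (t, y)) x = px (t, x)"
    and far: "\<And>t x. R \<le> \<bar>t\<bar> \<or> R \<le> \<bar>x\<bar> \<Longrightarrow> \<phi> (t, x) = 0 \<and> pt (t, x) = 0 \<and> px (t, x) = 0"
    and bd: "\<And>p. \<bar>\<phi> p\<bar> \<le> M \<and> \<bar>pt p\<bar> \<le> M \<and> \<bar>px p\<bar> \<le> M" and "0 < R"
    by (rule test_function_partials[OF assms(1)]) (rule that)
  have I: "integrable half_plane (\<lambda>p. case_prod v p * pt p)" "integrable half_plane (\<lambda>p. case_prod v p * px p)"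
    if "case_prod v \<in> Linf half_plane" for v
    using that far bd by (auto intro!: Linf_times_integrable[where R = R and M = M] cont)
  have J: "integrable lebesgue (\<lambda>x. v x * \<phi> (0, x))" if "v \<in> Linf lebesgue" for v
  proof -
    obtain B where vm: "v \<in> borel_measurable lebesgue" and B: "AE p in lebesgue. \<bar>v p\<bar> \<le> B"
      using \<open>v \<in> Linf lebesgue\<close> unfolding Linf_def by blast
    have "continuous_on UNIV (\<lambda>x. \<phi> (0, x))"
      by (rule continuous_on_compose2[OF cont(1)]) (auto intro!: continuous_intros)
    then have "(\<lambda>x. \<phi> (0, x)) \<in> borel_measurable lebesgue"
      by (intro measurable_completion) (simp add: borel_measurable_continuous_onI)
    then show ?thesis
    proof (intro bounded_box_integrable[where S = "{-R..R}" and B = "\<bar>B\<bar> * M"])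
      show "AE x in lebesgue. \<bar>v x * \<phi> (0, x)\<bar> \<le> \<bar>B\<bar> * M"
        using B
      proof (rule eventually_mono)
        fix x assume "\<bar>v x\<bar> \<le> B"
        then show "\<bar>v x * \<phi> (0, x)\<bar> \<le> \<bar>B\<bar> * M"
          unfolding abs_mult using bd[of "(0, x)"] by (intro mult_mono) auto
      qed
      show "v x * \<phi> (0, x) = 0" if "x \<notin> {-R..R}" for x
      proof -
        have "R \<le> \<bar>x\<bar>" using that by auto
        then show ?thesis using far by simp
      qed
    qed (use vm in auto)
  qed
  have lhs: "balance v F v0 \<phi> = (LINT p|half_plane. case_prod v p * pt p) + (LINT p|half_plane. case_prod F p * px p)
      + (LINT x|lebesgue. v0 x * \<phi> (0, x))"
    if "case_prod v \<in> Linf half_plane" "case_prod F \<in> Linf half_plane" for v F v0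
  proof -
    have "(LINT (t, x)|half_plane. v t x * pt (t, x) + F t x * px (t, x))
        = (LINT p|half_plane. case_prod v p * pt p + case_prod F p * px p)"
      by (intro Bochner_Integration.integral_cong) auto
    also have "\<dots> = (LINT p|half_plane. case_prod v p * pt p) + (LINT p|half_plane. case_prod F p * px p)"
      by (rule Bochner_Integration.integral_add[OF I(1)[OF that(1)] I(2)[OF that(2)]])
    finally show ?thesis by (simp add: balance_def dt dx half_plane_integral)
  qed
  have split: "case_prod (\<lambda>t x. v t x + v' t x) = (\<lambda>p. case_prod v p + case_prod v' p)" for v v' :: "real \<Rightarrow> real \<Rightarrow> real"
    by auto
  show ?thesis
    using I[OF w(1)] I[OF w(2)] I[OF G(1)] I[OF G(2)] J[OF w0(1)] J[OF w0(2)]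
    unfolding lhs[OF Linf_add[OF w, folded split] Linf_add[OF G, folded split]] lhs[OF w(1) G(1)] lhs[OF w(2) G(2)]
    by (simp add: distrib_right case_prod_beta)
qed

text \<open>The test function is a product of a time factor, decreasing for t > 0, and two cutoffs
  at the lateral boundaries. The speed bounds s1 w <= G <= s2 w give both boundary terms a
  nonpositive sign, and the initial term vanishes. So the integrand is nonpositive with nonnegative
  integral, hence 0, and the strictly negative time derivative forces w = 0.\<close>

lemma domain_of_dependence:
  fixes w G :: "real \<Rightarrow> real \<Rightarrow> real"
  assumes ent: "\<And>\<phi>. \<phi> \<in> test_functions \<Longrightarrow> 0 \<le> balance w G w0 \<phi>"
    and wG: "case_prod w \<in> Linf half_plane" "case_prod G \<in> Linf half_plane"
    and init: "\<And>x. x \<in> {a..b} \<Longrightarrow> w0 x = 0"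
    and cone: "AE (t, x) in half_plane. t < T \<and> a + s2 * t < x \<and> x < b + s1 * t \<longrightarrow>
      0 \<le> w t x \<and> s1 * w t x \<le> G t x \<and> G t x \<le> s2 * w t x"
    and T: "0 < T"
  shows "AE (t, x) in half_plane. t < T \<and> a + s2 * t < x \<and> x < b + s1 * t \<longrightarrow> w t x = 0"
proof -
  \<comment> \<open>The factor in T + t makes the support compact also towards negative times; it
    keeps the time factor even, hence decreasing for t > 0.\<close>
  define \<phi> where "\<phi> = (\<lambda>(t, x). (bump 0 (T - t) * bump 0 (T + t)) * (bump 0 (x - a - s2 * t) * bump 0 (b + s1 * t - x)))"
  have supp: "\<bar>t\<bar> < T \<and> a + s2 * t < x \<and> x < b + s1 * t" if "\<phi> (t, x) \<noteq> 0" for t x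
  proof -
    have "0 < y" if "bump 0 y \<noteq> 0" for y using that bump_nonpos by (meson not_le)
    from this[of "T - t"] this[of "T + t"] this[of "x - a - s2 * t"] this[of "b + s1 * t - x"]
    show ?thesis using that unfolding \<phi>_def by auto
  qed
  have test: "\<phi> \<in> test_functions"
  proof -
    have "Ck m \<phi>" for m
    proof -
      have l: "bounded_linear (\<lambda>p::real\<times>real. \<mu> * fst p + \<nu> * snd p)" for \<mu> \<nu>
        by (intro bounded_linear_add bounded_linear_mult_const bounded_linear_const_mult bounded_linear_fst bounded_linear_snd)
      have "Ck m (\<lambda>p. bump 0 ((-1 * fst p + 0 * snd p) + T) * bump 0 ((1 * fst p + 0 * snd p) + T) *
        (bump 0 ((- s2 * fst p + 1 * snd p) + - a) * bump 0 ((s1 * fst p + -1 * snd p) + b)))"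
        by (intro Ck_mult Ck_bump l)
      also have "(\<lambda>p. bump 0 ((-1 * fst p + 0 * snd p) + T) * bump 0 ((1 * fst p + 0 * snd p) + T) *
        (bump 0 ((- s2 * fst p + 1 * snd p) + - a) * bump 0 ((s1 * fst p + -1 * snd p) + b))) = \<phi>"
        by (auto simp: \<phi>_def algebra_simps)
      finally show ?thesis .
    qed
    moreover have "compact (closure {p. \<phi> p \<noteq> 0})"
    proof -
      define r where "r = \<bar>a\<bar> + \<bar>b\<bar> + (\<bar>s1\<bar> + \<bar>s2\<bar>) * T"
      have "{p. \<phi> p \<noteq> 0} \<subseteq> {-T..T} \<times> {-r..r}"
      proof clarify
        fix t x assume "\<phi> (t, x) \<noteq> 0"
        from supp[OF this] have s: "\<bar>t\<bar> < T" "a + s2 * t < x" "x < b + s1 * t" by auto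
        then have "\<bar>s1 * t\<bar> \<le> \<bar>s1\<bar> * T" "\<bar>s2 * t\<bar> \<le> \<bar>s2\<bar> * T"
          by (auto simp: abs_mult intro!: mult_left_mono)
        moreover have "0 \<le> \<bar>s1\<bar> * T" "0 \<le> \<bar>s2\<bar> * T" using T by auto
        ultimately have "-r \<le> x" "x \<le> r" using s unfolding r_def distrib_right by linarith+
        with s show "t \<in> {-T..T} \<and> x \<in> {-r..r}" by auto
      qed
      then have "bounded {p. \<phi> p \<noteq> 0}"
        by (rule bounded_subset[rotated]) (auto intro: bounded_Times)
      then show ?thesis by simp
    qed
    ultimately show ?thesis
      unfolding test_functions_def by (auto simp: \<phi>_def bump_nonneg)
  qed
  define e e' where "e t = bump 0 (T - t) * bump 0 (T + t)"
    and "e' t = bump 0 (T - t) * bump 2 (T + t) - bump 2 (T - t) * bump 0 (T + t)" for t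
  \<comment> \<open>Primed versions use \<open>bump 2\<close>, the derivative of
    \<open>bump 0\<close>.\<close>
  define l r l' r' where "l t x = bump 0 (x - a - s2 * t)" and "r t x = bump 0 (b + s1 * t - x)"
    and "l' t x = bump 2 (x - a - s2 * t)" and "r' t x = bump 2 (b + s1 * t - x)" for t x
  have dt: "deriv (\<lambda>s. \<phi> (s, x)) t = e' t * (l t x * r t x) + e t * (s1 * (l t x * r' t x) - s2 * (l' t x * r t x))" for t x
    unfolding \<phi>_def prod.case e_def e'_def l_def r_def l'_def r'_def
    by (rule DERIV_imp_deriv) (auto intro!: derivative_eq_intros simp: algebra_simps)
  have dx: "deriv (\<lambda>y. \<phi> (t, y)) x = e t * (l' t x * r t x - l t x * r' t x)" for t x
    unfolding \<phi>_def prod.case e_def e'_def l_def r_def l'_def r'_def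
    by (rule DERIV_imp_deriv) (auto intro!: derivative_eq_intros simp: algebra_simps)
  define f where "f t x = w t x * deriv (\<lambda>s. \<phi> (s, x)) t + G t x * deriv (\<lambda>y. \<phi> (t, y)) x" for t x
  \<comment> \<open>Sorted by which factor was differentiated: time, left boundary (moving with
    speed s2), right boundary (moving with speed s1).\<close>
  have f_eq: "f t x = w t x * e' t * (l t x * r t x) + e t * (l' t x * r t x) * (G t x - s2 * w t x)
      + e t * (l t x * r' t x) * (s1 * w t x - G t x)" for t x
    unfolding f_def dt dx by (simp add: algebra_simps)
  have nonneg: "0 \<le> e t" "0 \<le> l t x" "0 \<le> r t x" "0 \<le> l' t x" "0 \<le> r' t x" for t x
    by (simp_all add: e_def l_def r_def l'_def r'_def bump_nonneg)
  \<comment> \<open>The logarithmic derivative of \<open>e\<close> is 1/(T+t)^2 - 1/(T-t)^2.\<close>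
  have e'_neg: "e' t < 0" if "0 < t" "t < T" for t
  proof -
    have "bump 2 y = bump 0 y / y\<^sup>2" for y by (simp add: bump_def)
    then have "e' t = e t * (1 / (T + t)\<^sup>2 - 1 / (T - t)\<^sup>2)"
      unfolding e_def e'_def by (simp add: algebra_simps)
    moreover have "0 < e t" using that by (simp add: e_def bump_pos)
    moreover have "1 / (T + t)\<^sup>2 < 1 / (T - t)\<^sup>2"
      using that by (intro divide_strict_left_mono power_strict_mono) auto
    ultimately show ?thesis by (simp add: mult_less_0_iff)
  qed
  have outside: "f t x = 0" if "\<not> (t < T \<and> a + s2 * t < x \<and> x < b + s1 * t)" for t x
  proof -
    have "T \<le> t \<or> x \<le> a + s2 * t \<or> b + s1 * t \<le> x" using that by auto
    then show ?thesis
      by (elim disjE) (simp_all add: f_eq e_def e'_def l_def l'_def r_def r'_def bump_nonpos)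
  qed
  have inside: "f t x \<le> w t x * (e' t * (l t x * r t x))" 
    if "s1 * w t x \<le> G t x" "G t x \<le> s2 * w t x" for t x
  proof -
    have "e t * (l' t x * r t x) * (G t x - s2 * w t x) \<le> 0" "e t * (l t x * r' t x) * (s1 * w t x - G t x) \<le> 0"
      using that nonneg by (auto intro!: mult_nonneg_nonpos)
    then show ?thesis unfolding f_eq by (simp add: mult.assoc)
  qed
  have neg: "AE p in half_plane. 0 \<le> - case_prod f p"
    using cone half_plane_time_pos
  proof eventually_elim
    case (elim p)
    obtain t x where p: "p = (t, x)" by (cases p)
    show ?case
    proof (cases "t < T \<and> a + s2 * t < x \<and> x < b + s1 * t")
      case True
      with elim p have *: "0 \<le> w t x" "s1 * w t x \<le> G t x" "G t x \<le> s2 * w t x" "0 < t" by auto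
      have "w t x * (e' t * (l t x * r t x)) \<le> 0"
        using * True e'_neg[of t] nonneg by (intro mult_nonneg_nonpos mult_nonpos_nonneg mult_nonneg_nonneg) auto
      then show ?thesis using inside[OF *(2,3)] by (simp add: p)
    qed (simp add: p outside)
  qed
  have int: "integrable half_plane (case_prod f)"
  proof -
    obtain pt px R M where cont: "continuous_on UNIV \<phi>" "continuous_on UNIV pt" "continuous_on UNIV px"
      and D: "\<And>p. (\<phi> has_derivative (\<lambda>(h, k). h * pt p + k * px p)) (at p)"
      and dt: "\<And>t x. deriv (\<lambda>s. \<phi> (s, x)) t = pt (t, x)"
      and dx: "\<And>t x. deriv (\<lambda>y. \<phi> (t, y)) x = px (t, x)"
      and far: "\<And>t x. R \<le> \<bar>t\<bar> \<or> R \<le> \<bar>x\<bar> \<Longrightarrow> \<phi> (t, x) = 0 \<and> pt (t, x) = 0 \<and> px (t, x) = 0"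
      and bd: "\<And>p. \<bar>\<phi> p\<bar> \<le> M \<and> \<bar>pt p\<bar> \<le> M \<and> \<bar>px p\<bar> \<le> M" and "0 < R"
      by (rule test_function_partials[OF test]) (rule that)
    have "integrable half_plane (\<lambda>p. case_prod w p * pt p + case_prod G p * px p)"
      using far bd wG by (intro Bochner_Integration.integrable_add Linf_times_integrable[where R = R and M = M] cont) auto
    also have "(\<lambda>p. case_prod w p * pt p + case_prod G p * px p) = case_prod f"
      by (auto simp: f_def dt dx)
    finally show ?thesis .
  qed
  have init0: "(\<lambda>x. w0 x * \<phi> (0, x)) = (\<lambda>_. 0)"
    using supp[of 0] init by fastforce
  have "0 \<le> integral\<^sup>L half_plane (case_prod f)"
    using ent[OF test] unfolding balance_def half_plane_integral f_def[symmetric] init0 by simp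
  moreover have "0 \<le> (LINT p|half_plane. - case_prod f p)"
    using neg by (rule integral_nonneg_AE)
  ultimately have "(LINT p|half_plane. - case_prod f p) = 0" by simp
  then have "AE p in half_plane. - case_prod f p = 0"
    by (subst (asm) integral_nonneg_eq_0_iff_AE) (use int neg in auto)
  then show ?thesis
    using cone half_plane_time_pos
  proof eventually_elim
    case (elim p)
    obtain t x where p: "p = (t, x)" by (cases p)
    show ?case unfolding p prod.case
    proof
      assume r: "t < T \<and> a + s2 * t < x \<and> x < b + s1 * t"
      with elim p have *: "0 \<le> w t x" "s1 * w t x \<le> G t x" "G t x \<le> s2 * w t x" "0 < t" "f t x = 0" by auto
      then have "0 \<le> w t x * (e' t * (l t x * r t x))" using inside[OF *(2,3)] by simp
      moreover have "e' t * (l t x * r t x) < 0"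
        using r *(4) e'_neg[of t] by (intro mult_neg_pos mult_pos_pos) (auto simp: l_def r_def intro!: bump_pos)
      ultimately show "w t x = 0" using *(1) mult_pos_neg by (metis le_less not_le)
    qed
  qed
qed

section \<open>The flux\<close>

definition ramp :: "nat \<Rightarrow> real \<Rightarrow> real" where
  "ramp m x = max 0 (min 1 ((x + 8 * real m) * 4 ^ Suc m))"

text \<open>The weights from index k on sum to (1/2)^k, so switching on one more ramp, moving right,
  doubles the value.\<close>

definition \<rho> :: "real \<Rightarrow> real" where
  "\<rho> x = (\<Sum>m. (1/2) ^ Suc m * ramp m x)"

definition coef :: "real \<Rightarrow> real" where
  "coef x = (\<rho> x)\<^sup>2 * (2 + cos (pi / \<rho> x))"

text \<open>\<open>coef\<close> tends to 0 at minus infinity, so the first summand alone has no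
  coercive lower bound uniform in x, as (B-3) demands. The second summand supplies it while leaving
  the flux linear on [0,1].\<close>

definition flux :: "real \<Rightarrow> real \<Rightarrow> real" where
  "flux x u = coef x * \<bar>u\<bar> + max 0 (\<bar>u\<bar> - 1)"

lemma ramp_bounds: "0 \<le> ramp m x" "ramp m x \<le> 1"
  by (auto simp: ramp_def)

lemma ramp_mono: "x \<le> y \<Longrightarrow> ramp m x \<le> ramp m y"
  unfolding ramp_def by (intro max.mono min.mono mult_right_mono order_refl) auto

lemma ramp_eq_0: "x \<le> - 8 * real m \<Longrightarrow> ramp m x = 0"
  using mult_nonpos_nonneg[of "x + 8 * real m" "4 ^ Suc m"] by (simp add: ramp_def del: power_Suc)

lemma ramp_eq_1:
  assumes "- 8 * real m + (1/4) ^ Suc m \<le> x"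
  shows "ramp m x = 1"
proof -
  have "(1/4) ^ Suc m * 4 ^ Suc m \<le> (x + 8 * real m) * 4 ^ Suc m"
    using assms by (intro mult_right_mono) auto
  moreover have "(1/4::real) ^ Suc m * 4 ^ Suc m = 1"
    unfolding power_mult_distrib[symmetric] by simp
  ultimately show ?thesis unfolding ramp_def by linarith
qed

lemma summable_half: "summable (\<lambda>m. (1/2::real) ^ Suc m)" and suminf_half: "(\<Sum>m. (1/2::real) ^ Suc m) = 1"
  using power_half_series by (auto simp: sums_iff)

lemma summable_\<rho>: "summable (\<lambda>m. (1/2) ^ Suc m * ramp m x)"
  by (rule summable_comparison_test'[OF summable_half, of 0])
    (use ramp_bounds in \<open>auto simp: abs_mult intro!: mult_left_le\<close>)

lemma \<rho>_mono: "x \<le> y \<Longrightarrow> \<rho> x \<le> \<rho> y"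
  unfolding \<rho>_def by (intro suminf_le summable_\<rho> mult_left_mono ramp_mono) auto

lemma \<rho>_le_1: "\<rho> x \<le> 1"
proof -
  have "\<rho> x \<le> (\<Sum>m. (1/2::real) ^ Suc m)"
    unfolding \<rho>_def using ramp_bounds
    by (intro suminf_le summable_\<rho> summable_half mult_left_le) auto
  then show ?thesis by (simp only: suminf_half)
qed

lemma \<rho>_pos: "0 < \<rho> x"
proof -
  obtain m :: nat where "- x / 8 < real m" using reals_Archimedean2 by blast
  then have "0 < ramp m x" by (auto simp: ramp_def)
  then show ?thesis
    unfolding \<rho>_def using ramp_bounds by (intro suminf_pos2[OF summable_\<rho>, of _ m]) auto
qed

lemma \<rho>_cont: "continuous_on UNIV \<rho>"
proof -
  have "uniform_limit UNIV (\<lambda>n x. \<Sum>m<n. (1/2) ^ Suc m * ramp m x) \<rho> sequentially"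
    unfolding \<rho>_def
  proof (rule Weierstrass_m_test[OF _ summable_half])
    show "norm ((1/2) ^ Suc m * ramp m x) \<le> (1/2) ^ Suc m" for m x
      using ramp_bounds[of m x] by (simp add: abs_mult mult_left_le del: power_Suc)
  qed
  moreover have "continuous_on UNIV (\<lambda>x. \<Sum>m<n. (1/2) ^ Suc m * ramp m x)" for n
    unfolding ramp_def by (intro continuous_intros)
  ultimately show ?thesis
    by (intro uniform_limit_theorem[of _ "\<lambda>n x. \<Sum>m<n. (1/2) ^ Suc m * ramp m x" sequentially]) auto
qed

lemma \<rho>_eq:
  assumes "\<And>j. j < k \<Longrightarrow> ramp j x = 0" "\<And>j. k \<le> j \<Longrightarrow> ramp j x = 1"
  shows "\<rho> x = (1/2) ^ k"
proof -
  have "\<rho> x = (\<Sum>j. (1/2) ^ Suc (j + k) * ramp (j + k) x) + (\<Sum>j<k. (1/2) ^ Suc j * ramp j x)"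
    unfolding \<rho>_def by (rule suminf_split_initial_segment[OF summable_\<rho>])
  also have "\<dots> = (\<Sum>j. (1/2) ^ k * (1/2) ^ Suc j)"
    using assms by (simp add: power_add mult_ac)
  also have "\<dots> = (1/2) ^ k"
    using suminf_mult[OF summable_half, of "(1/2) ^ k"] by (simp only: suminf_half mult_1_right)
  finally show ?thesis .
qed

text \<open>Ramp m+1 starts at -8m-8 and is saturated by -8m-7, while ramp m starts only at -8m; the
  interval in between lies in a flat region.\<close>

lemma \<rho>_plateau:
  assumes "- 8 * real m - 6 \<le> x" "x \<le> - 8 * real m"
  shows "\<rho> x = (1/2) ^ Suc m"
proof (rule \<rho>_eq)
  show "ramp j x = 0" if "j < Suc m" for j
    using that assms by (intro ramp_eq_0) auto
  show "ramp j x = 1" if "Suc m \<le> j" for j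
  proof (rule ramp_eq_1)
    have "(1/4::real) ^ Suc j \<le> 1" by (intro power_le_one) auto
    moreover have "real m + 1 \<le> real j" using that by linarith
    ultimately show "- 8 * real j + (1/4) ^ Suc j \<le> x" using assms by linarith
  qed
qed

lemma \<rho>_top: "\<rho> (- 8 * real m + (1/4) ^ Suc m) = (1/2) ^ m"
proof (rule \<rho>_eq)
  have le: "(1/4::real) ^ Suc j \<le> 1" for j by (intro power_le_one) auto
  show "ramp j (- 8 * real m + (1/4) ^ Suc m) = 0" if "j < m" for j
    using that le[of m] by (intro ramp_eq_0) auto
  show "ramp j (- 8 * real m + (1/4) ^ Suc m) = 1" if "m \<le> j" for j
  proof (rule ramp_eq_1)
    have "(1/4::real) ^ Suc j \<le> (1/4) ^ Suc m" using that by (intro power_decreasing) auto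
    then show "- 8 * real j + (1/4) ^ Suc j \<le> - 8 * real m + (1/4) ^ Suc m" using that by linarith
  qed
qed

lemma coef_bounds: "(\<rho> x)\<^sup>2 \<le> coef x" "coef x \<le> 3 * (\<rho> x)\<^sup>2"
proof -
  have "(\<rho> x)\<^sup>2 * 1 \<le> coef x"
    unfolding coef_def
  proof (rule mult_left_mono)
    show "1 \<le> 2 + cos (pi / \<rho> x)" using cos_ge_minus_one[of "pi / \<rho> x"] by linarith
  qed simp
  then show "(\<rho> x)\<^sup>2 \<le> coef x" by simp
  have "coef x \<le> (\<rho> x)\<^sup>2 * 3"
    unfolding coef_def by (intro mult_left_mono) auto
  then show "coef x \<le> 3 * (\<rho> x)\<^sup>2" by simp
qed

lemma coef_pos: "0 < coef x"
  using coef_bounds(1)[of x] \<rho>_pos[of x] by (meson less_le_trans zero_less_power)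

lemma coef_le_3: "coef x \<le> 3"
proof -
  have "(\<rho> x)\<^sup>2 \<le> 1" using \<rho>_pos[of x] \<rho>_le_1[of x] by (intro power_le_one) auto
  then show ?thesis using coef_bounds(2)[of x] by linarith
qed

text \<open>\<open>coef\<close> oscillates but is comparable, up to the factor 3, to the square of
  the monotone profile. A datum below 1/3 absorbs this factor, which keeps the transported wave
  below 1, where the flux is linear.\<close>

lemma coef_le_3_coef:
  assumes "x \<le> y"
  shows "coef x \<le> 3 * coef y"
proof -
  have "(\<rho> x)\<^sup>2 \<le> (\<rho> y)\<^sup>2" using \<rho>_mono[OF assms] \<rho>_pos[of x] by (intro power_mono) auto
  then show ?thesis using coef_bounds(2)[of x] coef_bounds(1)[of y] by linarith
qed

lemma coef_cont: "continuous_on UNIV coef"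
proof -
  have "\<rho> x \<noteq> 0" for x using \<rho>_pos[of x] by simp
  then show ?thesis
    unfolding coef_def by (intro continuous_intros \<rho>_cont) simp
qed

text \<open>In the derivative of s^2 (2 + cos(pi/s)) the factor s^2 cancels the 1/s^2 of the inner
  derivative, so it stays below 6 + 4 on (0,1].\<close>

lemma coef_diff: "\<bar>coef x - coef y\<bar> \<le> 10 * \<bar>\<rho> x - \<rho> y\<bar>"
proof -
  define \<Gamma> where "\<Gamma> s = s\<^sup>2 * (2 + cos (pi / s))" for s :: real
  have "norm (\<Gamma> (\<rho> x) - \<Gamma> (\<rho> y)) \<le> 10 * norm (\<rho> x - \<rho> y)"
  proof (rule field_differentiable_bound[where S = "{0<..1}"])
    fix s :: real assume s: "s \<in> {0<..1}"
    show "(\<Gamma> has_real_derivative 2 * s * (2 + cos (pi / s)) + pi * sin (pi / s)) (at s within {0<..1})"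
      unfolding \<Gamma>_def using s by (auto intro!: derivative_eq_intros simp: power2_eq_square field_simps)
    have "\<bar>2 * s * (2 + cos (pi / s))\<bar> \<le> 2 * 3"
      unfolding abs_mult
    proof (rule mult_mono)
      show "\<bar>2 + cos (pi / s)\<bar> \<le> 3"
        using cos_ge_minus_one[of "pi / s"] cos_le_one[of "pi / s"] by linarith
    qed (use s in auto)
    moreover have "\<bar>pi * sin (pi / s)\<bar> \<le> 4 * 1"
      unfolding abs_mult using pi_less_4 pi_gt_zero by (intro mult_mono) auto
    ultimately show "norm (2 * s * (2 + cos (pi / s)) + pi * sin (pi / s)) \<le> 10"
      by (simp del: abs_mult)
  qed (use \<rho>_pos \<rho>_le_1 in \<open>auto intro: convex_real_interval\<close>)
  then show ?thesis by (simp add: \<Gamma>_def coef_def)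
qed

section \<open>Elementary estimates for the flux and the structural assumptions\<close>

lemma flux_even: "flux x (- u) = flux x u"
  by (simp add: flux_def)

text \<open>Bounds the propagation speed on nonnegative states from below by
  \<open>coef x\<close>.\<close>

lemma flux_mono: "0 \<le> u \<Longrightarrow> u \<le> v \<Longrightarrow> coef x * (v - u) \<le> flux x v - flux x u"
  by (auto simp: flux_def algebra_simps max_def)

lemma flux_less: "0 \<le> u \<Longrightarrow> u < v \<Longrightarrow> flux x u < flux x v"
  using flux_mono[of u v x] mult_pos_pos[OF coef_pos[of x], of "v - u"] by simp

text \<open>Slope at most 3 from the coefficient plus 1 from the second summand; 4 thus bounds all
  propagation speeds.\<close>

lemma flux_Lipschitz: "\<bar>flux x u - flux x v\<bar> \<le> 4 * \<bar>u - v\<bar>"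
proof -
  have "\<bar>coef x * \<bar>u\<bar> - coef x * \<bar>v\<bar>\<bar> = coef x * \<bar>\<bar>u\<bar> - \<bar>v\<bar>\<bar>"
    using coef_pos[of x] by (simp add: abs_mult flip: right_diff_distrib)
  also have "\<dots> \<le> 3 * \<bar>u - v\<bar>"
    using coef_pos[of x] coef_le_3[of x] by (intro mult_mono) auto
  finally have "\<bar>coef x * \<bar>u\<bar> - coef x * \<bar>v\<bar>\<bar> \<le> 3 * \<bar>u - v\<bar>" .
  moreover have "\<bar>max 0 (\<bar>u\<bar> - 1) - max 0 (\<bar>v\<bar> - 1)\<bar> \<le> \<bar>u - v\<bar>"
    by (auto simp: max_def)
  moreover have "\<bar>p + r - (q + s)\<bar> \<le> 4 * d" if "\<bar>p - q\<bar> \<le> 3 * d" "\<bar>r - s\<bar> \<le> d" for p q r s d :: real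
    using that by linarith
  ultimately show ?thesis unfolding flux_def by blast
qed

lemma flux_0 [simp]: "flux x 0 = 0"
  by (simp add: flux_def)

lemma flux_nonneg: "0 \<le> flux x u"
  using coef_pos[of x] by (simp add: flux_def)

lemma flux_A1: "A1 flux {}"
proof -
  have "continuous_on UNIV (\<lambda>p::real \<times> real. coef (fst p))"
    by (rule continuous_on_compose2[OF coef_cont]) (auto intro!: continuous_intros)
  then have "continuous_on UNIV (\<lambda>p. flux (fst p) (snd p))"
    unfolding flux_def by (intro continuous_intros)
  then show ?thesis by (simp add: A1_def case_prod_beta)
qed

lemma flux_A2: "A2 flux"
  unfolding A2_def
proof (intro exI[of _ "\<lambda>_::real. 4::real"] conjI allI impI)
  show "bounded ((\<lambda>_. 4::real) ` K)" for K :: "real set"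
    by (rule bounded_subset[of "{4}"]) auto
qed (simp add: flux_Lipschitz)

lemma flux_eq_0_iff: "flux x u = 0 \<longleftrightarrow> u = 0"
proof -
  have "flux x u = flux x \<bar>u\<bar>" by (simp add: flux_def)
  then show ?thesis using flux_less[of 0 "\<bar>u\<bar>" x] by (cases "u = 0") auto
qed

lemma flux_A3: "A3 flux {} (\<lambda>_. 0) (\<lambda>_. 0)"
proof -
  have "strict_antimono_on {..0} (flux x)" for x
  proof (rule monotone_onI)
    fix u v :: real assume "u \<in> {..0}" "v \<in> {..0}" "u < v"
    then show "flux x v < flux x u" using flux_less[of "- v" "- u" x] by (simp add: flux_even)
  qed
  then show ?thesis
    unfolding A3_def by (auto simp: flux_eq_0_iff intro!: strict_mono_onI flux_less)
qed

text \<open>Only \<open>coef\<close> depends on x, so \<open>coef_diff\<close> allows 10|u| for the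
  growth function and the monotone, bounded \<open>\<rho>\<close> for the function of bounded
  variation.\<close>

lemma flux_B1: "B1 flux"
proof -
  have "\<bar>flux x u - flux y u\<bar> \<le> (10 * \<bar>u\<bar>) * \<bar>\<rho> x - \<rho> y\<bar>" for x y u
  proof -
    have "\<bar>flux x u - flux y u\<bar> = \<bar>u\<bar> * \<bar>coef x - coef y\<bar>"
      by (simp add: flux_def abs_mult flip: left_diff_distrib)
    also have "\<dots> \<le> \<bar>u\<bar> * (10 * \<bar>\<rho> x - \<rho> y\<bar>)" by (intro mult_left_mono coef_diff) auto
    finally show ?thesis by simp
  qed
  moreover have "\<rho> \<in> BV"
    by (rule bounded_mono_BV[where B = 1]) (auto intro: monoI \<rho>_mono \<rho>_le_1 less_imp_le[OF \<rho>_pos])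
  moreover have "continuous_on UNIV (\<lambda>u::real. 10 * \<bar>u\<bar>)" by (intro continuous_intros)
  ultimately show ?thesis unfolding B1_def by blast
qed

lemma convex_cut_abs: "convex_on UNIV (\<lambda>u::real. max 0 (\<bar>u\<bar> - 1))"
proof (rule convex_onI)
  fix t x y :: real assume t: "0 < t" "t < 1"
  have "\<bar>(1 - t) * x + t * y\<bar> \<le> (1 - t) * \<bar>x\<bar> + t * \<bar>y\<bar>"
    using t abs_triangle_ineq[of "(1 - t) * x" "t * y"] by (simp add: abs_mult)
  also have "\<dots> \<le> (1 - t) * (max 0 (\<bar>x\<bar> - 1) + 1) + t * (max 0 (\<bar>y\<bar> - 1) + 1)"
    using t by (intro add_mono mult_left_mono) auto
  finally have "\<bar>(1 - t) * x + t * y\<bar> - 1 \<le> (1 - t) * max 0 (\<bar>x\<bar> - 1) + t * max 0 (\<bar>y\<bar> - 1)"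
    by (simp add: algebra_simps)
  moreover have "0 \<le> (1 - t) * max 0 (\<bar>x\<bar> - 1) + t * max 0 (\<bar>y\<bar> - 1)" using t by simp
  ultimately show "max 0 (\<bar>(1 - t) *\<^sub>R x + t *\<^sub>R y\<bar> - 1)
      \<le> (1 - t) * max 0 (\<bar>x\<bar> - 1) + t * max 0 (\<bar>y\<bar> - 1)"
    by simp
qed simp

lemma convex_cone_abs: "0 \<le> c \<Longrightarrow> convex_on UNIV (\<lambda>u::real. c * \<bar>u\<bar> + max 0 (\<bar>u\<bar> - 1))"
  using convex_on_dist[of "UNIV :: real set" 0]
  by (intro convex_on_add convex_on_cmul convex_cut_abs) (simp_all add: dist_real_def)

lemma flux_B2: "B2 flux"
  unfolding B2_def flux_def[abs_def] using coef_pos by (auto intro: convex_cone_abs less_imp_le)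

lemma flux_B3: "B3 flux"
proof -
  have "filterlim (\<lambda>u::real. \<bar>u\<bar> - 1) at_top at_infinity"
    using filterlim_tendsto_add_at_top[OF tendsto_const[of "-1::real"] filterlim_norm_at_top[where 'a = real]] by simp
  then have "filterlim (\<lambda>u::real. max 0 (\<bar>u\<bar> - 1)) at_top at_infinity"
    by (rule filterlim_at_top_mono) auto
  moreover have "max 0 (\<bar>u\<bar> - 1) \<le> \<bar>flux x u\<bar>" "\<bar>flux x u\<bar> \<le> 3 * \<bar>u\<bar> + max 0 (\<bar>u\<bar> - 1)" for x u
    using flux_nonneg[of x u] coef_le_3[of x] coef_pos[of x] mult_right_mono[of "coef x" 3 "\<bar>u\<bar>"]
    by (auto simp: flux_def)
  ultimately show ?thesis
    unfolding B3_def using convex_cut_abs convex_cone_abs[of 3]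
    by (intro exI[of _ "\<lambda>u. max 0 (\<bar>u\<bar> - 1)"] exI[of _ "\<lambda>u. 3 * \<bar>u\<bar> + max 0 (\<bar>u\<bar> - 1)"]) auto
qed

lemma flux_B4: "B4 (\<lambda>_. 0) (\<lambda>_. 0)"
  using bounded_mono_BV[of "\<lambda>_. 0" 0] by (simp add: B4_def uM_def[abs_def] mono_def)

section \<open>Stationary states of the flux\<close>

text \<open>The flux equals \<open>coef x\<close> at u = 1. Below this level alpha = c k is to be
  solved, above it alpha = c k + k - 1.\<close>

lemma flux_k_plus:
  assumes "0 \<le> \<alpha>"
  shows "k_plus flux (\<lambda>_. 0) \<alpha> = (\<lambda>x. if \<alpha> \<le> coef x then \<alpha> / coef x else (\<alpha> + 1) / (1 + coef x))"
    (is "_ = ?k")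
proof
  fix x
  have k: "0 \<le> ?k x" "flux x (?k x) = \<alpha>"
    using assms coef_pos[of x] by (auto simp: flux_def divide_simps max_def) (auto simp: algebra_simps)
  show "k_plus flux (\<lambda>_. 0) \<alpha> x = ?k x"
    unfolding k_plus_def
  proof (rule the_equality)
    show "k = ?k x" if "0 \<le> k \<and> flux x k = \<alpha>" for k
      using that k flux_less[of k "?k x" x] flux_less[of "?k x" k x] by linarith
  qed (use k in simp)
qed

lemma flux_at_k_plus:
  assumes "0 \<le> \<alpha>"
  shows "flux x (k_plus flux (\<lambda>_. 0) \<alpha> x) = \<alpha>"
  unfolding flux_k_plus[OF assms]
  using assms coef_pos[of x] by (auto simp: flux_def divide_simps max_def) (auto simp: algebra_simps)

lemma flux_k_plus_nonneg: "0 \<le> \<alpha> \<Longrightarrow> 0 \<le> k_plus flux (\<lambda>_. 0) \<alpha> x"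
  using coef_pos[of x] by (simp add: flux_k_plus)

lemma flux_k_minus:
  assumes "0 \<le> \<alpha>"
  shows "k_minus flux (\<lambda>_. 0) \<alpha> = (\<lambda>x. - k_plus flux (\<lambda>_. 0) \<alpha> x)"
proof
  fix x
  note k = flux_k_plus_nonneg[OF assms, of x] flux_at_k_plus[OF assms, of x]
  show "k_minus flux (\<lambda>_. 0) \<alpha> x = - k_plus flux (\<lambda>_. 0) \<alpha> x"
    unfolding k_minus_def
  proof (rule the_equality)
    fix k assume "k \<le> 0 \<and> flux x k = \<alpha>"
    then have "0 \<le> - k" "flux x (- k) = \<alpha>" by (simp_all add: flux_even)
    with k have "- k = k_plus flux (\<lambda>_. 0) \<alpha> x"
      using flux_less[of _ _ x] by (metis less_irrefl linorder_neqE)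
    then show "k = - k_plus flux (\<lambda>_. 0) \<alpha> x" by simp
  qed (use k in \<open>auto simp: flux_even\<close>)
qed

section \<open>The initial datum\<close>

text \<open>The ratio lies below 1, so the heights are summable, but above 1/2, so that 2^m times
  the height is unbounded. The divisor 9 makes the total 1/3, matching the factor 3 of
  \<open>coef_le_3_coef\<close>.\<close>

definition amp :: "nat \<Rightarrow> real" where
  "amp m = (2/3) ^ m / 9"

text \<open>Total height of the intervals [-8m-6, -8m] whose left end has been reached;
  \<open>exited\<close> counts those whose right end has been passed. Writing the datum as a
  difference of bounded nondecreasing functions yields measurability, countably many discontinuities
  and the potential for \<open>\<Lambda>\<close>.\<close>

definition entered :: "real \<Rightarrow> real" where
  "entered x = (\<Sum>m. if - 8 * real m - 6 \<le> x then amp m else 0)"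

definition exited :: "real \<Rightarrow> real" where
  "exited x = (\<Sum>m. if - 8 * real m < x then amp m else 0)"

definition datum :: "real \<Rightarrow> real" where
  "datum x = entered x - exited x"

lemma amp_nonneg: "0 \<le> amp m" by (simp add: amp_def)

lemma summable_amp: "summable amp" and suminf_amp: "suminf amp = 1/3"
proof -
  have "amp sums ((1 / (1 - 2/3)) / 9)"
    unfolding amp_def[abs_def] by (intro sums_divide geometric_sums) auto
  then show "summable amp" "suminf amp = 1/3" by (auto simp: sums_iff)
qed

lemma summable_if_amp: "summable (\<lambda>m. if P m then amp m else 0)"
  by (rule summable_comparison_test'[OF summable_amp, of 0]) (auto simp: amp_nonneg)

lemma suminf_if_amp_mono: "(\<And>m. P m \<Longrightarrow> Q m) \<Longrightarrow> (\<Sum>m. if P m then amp m else 0) \<le> (\<Sum>m. if Q m then amp m else 0)"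
  by (intro suminf_le summable_if_amp) (auto simp: amp_nonneg)

lemma mono_entered: "mono entered" and mono_exited: "mono exited"
  unfolding mono_def entered_def exited_def by (auto intro!: suminf_if_amp_mono)

lemma exited_nonneg: "0 \<le> exited x"
  unfolding exited_def by (intro suminf_nonneg summable_if_amp) (auto simp: amp_nonneg)

lemma entered_le: "entered x \<le> 1/3"
  using suminf_if_amp_mono[of "\<lambda>m. - 8 * real m - 6 \<le> x" "\<lambda>_. True"] suminf_amp by (simp add: entered_def)

lemma datum_nonneg: "0 \<le> datum x"
  unfolding datum_def entered_def exited_def using suminf_if_amp_mono[of "\<lambda>m. - 8 * real m < x"] by fastforce

lemma datum_le: "datum x \<le> 1/3"
  using entered_le[of x] exited_nonneg[of x] by (simp add: datum_def)

lemma datum_measurable [measurable]: "datum \<in> borel_measurable borel"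
  unfolding datum_def[abs_def] using mono_entered mono_exited
  by (intro borel_measurable_diff borel_measurable_mono)

lemma countable_datum_discont: "countable {x. \<not> isCont datum x}"
proof -
  have "{x. \<not> isCont datum x} \<subseteq> {x. \<not> isCont entered x} \<union> {x. \<not> isCont exited x}"
    unfolding datum_def[abs_def] by (auto intro: continuous_diff)
  then show ?thesis
    using mono_ctble_discont[OF mono_entered] mono_ctble_discont[OF mono_exited] countable_subset
    by (metis countable_Un)
qed

lemma datum_launch:
  assumes "- 8 * real m - 6 \<le> x" "x \<le> - 8 * real m"
  shows "datum x = amp m"
proof -
  have "datum x = (\<Sum>j. (if - 8 * real j - 6 \<le> x then amp j else 0) - (if - 8 * real j < x then amp j else 0))"
    unfolding datum_def entered_def exited_def by (intro suminf_diff summable_if_amp)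
  also have "(\<lambda>j. (if - 8 * real j - 6 \<le> x then amp j else 0) - (if - 8 * real j < x then amp j else 0))
      = (\<lambda>j. if j = m then amp m else 0)"
  proof
    fix j
    consider "j = m" | "real j + 1 \<le> real m" | "real m + 1 \<le> real j" by linarith
    then show "(if - 8 * real j - 6 \<le> x then amp j else 0) - (if - 8 * real j < x then amp j else 0) = (if j = m then amp m else 0)"
      using assms by cases auto
  qed
  also have "(\<Sum>j. if j = m then amp m else 0) = amp m"
    using sums_single[of m amp] by (simp add: sums_iff cong: if_cong) 
  finally show ?thesis .
qed

text \<open>\<open>entered + exited\<close> is the potential for \<open>chain_sum_le\<close>. For
  equal fluxes the increments of both monotone parts bound the jump. For different fluxes the claim
  datum x + datum y <= V y - V x amounts to entered x <= exited y.\<close>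

lemma datum_\<Lambda>: "\<Lambda> flux (\<lambda>_. 0) (\<lambda>_. 0) datum < \<infinity>"
proof -
  define V where "V x = entered x + exited x" for x
  have step: "\<Delta>w flux (\<lambda>_. 0) (\<lambda>_. 0) datum x y \<le> V y - V x" if "x < y" for x y
  proof (cases "flux x = flux y")
    case True
    have "entered x \<le> entered y" "exited x \<le> exited y"
      using monoD[OF mono_entered less_imp_le[OF that]] monoD[OF mono_exited less_imp_le[OF that]] by auto
    with True show ?thesis by (auto simp: \<Delta>w_def V_def datum_def)
  next
    case False
    \<comment> \<open>An interval entered by x but not exited by y contains both points, and the
      flux is the same throughout such an interval.\<close>
    have "entered x \<le> exited y"
      unfolding entered_def exited_def
    proof (rule suminf_if_amp_mono, rule ccontr)
      fix m assume "- 8 * real m - 6 \<le> x" "\<not> - 8 * real m < y"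
      then have "\<rho> x = \<rho> y" using that \<rho>_plateau[of m x] \<rho>_plateau[of m y] by simp
      then have "flux x = flux y" by (simp add: fun_eq_iff flux_def coef_def)
      with False show False ..
    qed
    with False show ?thesis
      using datum_nonneg[of x] datum_nonneg[of y] by (simp add: \<Delta>w_def uM_def V_def datum_def)
  qed
  have "\<Lambda> flux (\<lambda>_. 0) (\<lambda>_. 0) datum \<le> ereal (2/3)"
    unfolding \<Lambda>_def
  proof (rule chain_sum_le[OF step])
    fix x show "0 \<le> V x" "V x \<le> 2/3"
      using datum_nonneg[of x] exited_nonneg[of x] entered_le[of x] by (auto simp: V_def datum_def)
  qed
  then show ?thesis by (rule order_le_less_trans) simp
qed

section \<open>Existence\<close>

text \<open>Local bounds suffice because of the support of \<open>g\<close>; this admits the factor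
  1/\<open>coef\<close>, which is unbounded on the line.\<close>

lemma locally_bounded_times_integrable:
  fixes f g :: "real \<times> real \<Rightarrow> real"
  assumes f: "f \<in> borel_measurable borel" "\<And>t x. 0 < t \<Longrightarrow> x \<in> {-R..R} \<Longrightarrow> \<bar>f (t, x)\<bar> \<le> B"
    and g: "continuous_on UNIV g" "\<And>p. \<bar>g p\<bar> \<le> M"
    and far: "\<And>t x. R \<le> \<bar>t\<bar> \<or> R \<le> \<bar>x\<bar> \<Longrightarrow> g (t, x) = 0"
  shows "integrable half_plane (\<lambda>p. f p * g p)"
proof -
  have "(\<lambda>p::real \<times> real. \<bar>snd p\<bar>) \<in> borel_measurable borel"
    by (intro borel_measurable_continuous_onI continuous_intros)
  with f(1) have "(\<lambda>p. if \<bar>snd p\<bar> \<le> R then f p else 0) \<in> borel_measurable borel" by measurable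
  then have "(\<lambda>p. if \<bar>snd p\<bar> \<le> R then f p else 0) \<in> borel_measurable half_plane"
    by (rule borel_imp_half_plane_measurable)
  moreover have "AE p in half_plane. \<bar>if \<bar>snd p\<bar> \<le> R then f p else 0\<bar> \<le> \<bar>B\<bar>"
  proof (rule AE_I2)
    fix p assume "p \<in> space half_plane"
    then obtain t x where p: "p = (t, x)" "0 < t" by (cases p) (auto simp: space_restrict_space)
    then show "\<bar>if \<bar>snd p\<bar> \<le> R then f p else 0\<bar> \<le> \<bar>B\<bar>" using f(2)[of t x] by (cases "\<bar>x\<bar> \<le> R") (auto simp: abs_le_iff)
  qed
  ultimately have "(\<lambda>p. if \<bar>snd p\<bar> \<le> R then f p else 0) \<in> Linf half_plane"
    unfolding Linf_def by blast
  from Linf_times_integrable[OF this g far]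
  have "integrable half_plane (\<lambda>p. (if \<bar>snd p\<bar> \<le> R then f p else 0) * g p)" .
  also have "(\<lambda>p. (if \<bar>snd p\<bar> \<le> R then f p else 0) * g p) = (\<lambda>p. f p * g p)"
    using far by (auto simp: fun_eq_iff)
  finally show ?thesis .
qed

text \<open>\<open>Y\<close> is an antiderivative of 1/c. Since c <= C, \<open>Y x - x / C\<close>
  is nondecreasing, so \<open>Y\<close> is unbounded in both directions and hits every
  value.\<close>

lemma characteristics_exist:
  assumes cont: "continuous_on UNIV c" and c: "\<And>x. 0 < c x" "\<And>x. c x \<le> C"
  obtains Y X where "characteristics c Y X"
proof -
  have "continuous_on UNIV (\<lambda>x. 1 / c x)"
    using c(1) by (intro continuous_intros cont) (metis less_irrefl)
  then obtain Y where Y: "\<And>x. (Y has_real_derivative 1 / c x) (at x)"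
    using einterval_antiderivative[of "-\<infinity>" "\<infinity>" "\<lambda>x. 1 / c x"]
    by (auto simp: continuous_on_eq_continuous_at has_real_derivative_iff_has_vector_derivative)
  have C: "0 < C" using c[of 0] by linarith
  have mono: "Y x - x / C \<le> Y y - y / C" if "x \<le> y" for x y
  proof (rule DERIV_nonneg_imp_nondecreasing[OF that])
    fix z
    have "((\<lambda>z. Y z - z / C) has_real_derivative 1 / c z - 1 / C) (at z)"
      by (rule derivative_eq_intros Y refl)+ (use C in auto)
    moreover have "1 / C \<le> 1 / c z" using c[of z] by (intro divide_left_mono) auto
    ultimately show "\<exists>d. ((\<lambda>z. Y z - z / C) has_real_derivative d) (at z) \<and> 0 \<le> d" by fastforce
  qed
  have "\<exists>x. Y x = z" for z
  proof -
    \<comment> \<open>At distance s from 0 the function \<open>Y\<close> has moved by at least |z| +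
      |Y 0|, so [-s,s] brackets z.\<close>
    define s where "s = C * (\<bar>z\<bar> + \<bar>Y 0\<bar>)"
    have s: "0 \<le> s" "s / C = \<bar>z\<bar> + \<bar>Y 0\<bar>" using C by (auto simp: s_def)
    have "\<exists>x\<ge>-s. x \<le> s \<and> Y x = z"
    proof (rule IVT')
      show "Y (- s) \<le> z" "z \<le> Y s" "- s \<le> s"
        using mono[of 0 s] mono[of "-s" 0] s by auto
      show "continuous_on {-s..s} Y"
        using Y by (meson DERIV_continuous_on has_field_derivative_at_within)
    qed
    then show ?thesis by blast
  qed
  then obtain X where "\<And>z. Y (X z) = z" by metis
  with Y cont c have "characteristics c Y X" by unfold_locales auto
  then show ?thesis by (rule that)
qed

context characteristics
begin

text \<open>Splits the density into a part carried along characteristics and a stationary part that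
  carries no flux; the balance of each is exactly 0. All entropy pairs of the explicit solution have
  this form.\<close>

lemma transport_balance:
  assumes \<phi>: "\<phi> \<in> test_functions"
    and Q [measurable]: "Q \<in> borel_measurable borel" and QB: "\<And>z. \<bar>Q z\<bar> \<le> B"
    and \<kappa> [measurable]: "\<kappa> \<in> borel_measurable borel" and \<kappa>B: "\<And>R. \<exists>B. \<forall>x\<in>{-R..R}. \<bar>\<kappa> x\<bar> \<le> B"
    and w: "\<And>t x. 0 < t \<Longrightarrow> w t x = Q (Y x - t) / c x + \<kappa> x"
    and G: "\<And>t x. 0 < t \<Longrightarrow> G t x = Q (Y x - t)"
    and w0: "\<And>x. w0 x = Q (Y x) / c x + \<kappa> x"
  shows "balance w G w0 \<phi> = 0"
proof -
  obtain pt px R M where cont: "continuous_on UNIV \<phi>" "continuous_on UNIV pt" "continuous_on UNIV px"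
    and D: "\<And>p. (\<phi> has_derivative (\<lambda>(h, k). h * pt p + k * px p)) (at p)"
    and dt: "\<And>t x. deriv (\<lambda>s. \<phi> (s, x)) t = pt (t, x)"
    and dx: "\<And>t x. deriv (\<lambda>y. \<phi> (t, y)) x = px (t, x)"
    and far: "\<And>t x. R \<le> \<bar>t\<bar> \<or> R \<le> \<bar>x\<bar> \<Longrightarrow> \<phi> (t, x) = 0 \<and> pt (t, x) = 0 \<and> px (t, x) = 0"
    and bd: "\<And>p. \<bar>\<phi> p\<bar> \<le> M \<and> \<bar>pt p\<bar> \<le> M \<and> \<bar>px p\<bar> \<le> M" and "0 < R"
    by (rule test_function_partials[OF \<phi>]) (rule that)
  obtain K where K: "\<forall>x\<in>{-R..R}. \<bar>\<kappa> x\<bar> \<le> K" using \<kappa>B by blast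
  have "\<exists>x0\<in>{-R..R}. \<forall>x\<in>{-R..R}. c x0 \<le> c x"
    using \<open>0 < R\<close> by (intro continuous_attains_inf continuous_on_subset[OF c_cont]) auto
  then obtain x0 where x0: "\<And>x. x \<in> {-R..R} \<Longrightarrow> c x0 \<le> c x" by blast
  have Qc: "\<bar>Q z / c x\<bar> \<le> B / c x0" if "x \<in> {-R..R}" for x z
    unfolding abs_divide using QB[of z] c_pos[of x0] c_pos[of x] x0[OF that] by (intro frac_le) auto
  have m: "(\<lambda>(t, x). Q (Y x - t)) \<in> borel_measurable borel" "(\<lambda>(t, x). Q (Y x - t) / c x) \<in> borel_measurable borel"
    "(\<lambda>(t::real, x). \<kappa> x) \<in> borel_measurable borel"
    unfolding borel_prod[symmetric] by measurable
  have I1: "integrable half_plane (\<lambda>p. (case p of (t, x) \<Rightarrow> Q (Y x - t)) * px p)"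
    using QB bd far by (intro locally_bounded_times_integrable[where R = R and M = M and B = B] m cont) auto
  have I2: "integrable half_plane (\<lambda>p. (case p of (t, x) \<Rightarrow> Q (Y x - t) / c x) * pt p)"
    using Qc bd far by (intro locally_bounded_times_integrable[where R = R and M = M and B = "B / c x0"] m cont) auto
  have I3: "integrable half_plane (\<lambda>p. (case p of (t, x) \<Rightarrow> \<kappa> x) * pt p)"
    using K bd far by (intro locally_bounded_times_integrable[where R = R and M = M and B = K] m cont) auto
  have I12: "integrable half_plane (\<lambda>(t, x). Q (Y x - t) * (pt (t, x) / c x + px (t, x)))"
  proof -
    have "(\<lambda>(t, x). Q (Y x - t) * (pt (t, x) / c x + px (t, x)))
        = (\<lambda>p. (case p of (t, x) \<Rightarrow> Q (Y x - t) / c x) * pt p + (case p of (t, x) \<Rightarrow> Q (Y x - t)) * px p)"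
      by (auto simp: fun_eq_iff algebra_simps)
    then show ?thesis using Bochner_Integration.integrable_add[OF I2 I1] by (simp only:)
  qed
  have I3': "integrable half_plane (\<lambda>(t, x). \<kappa> x * pt (t, x))"
  proof -
    have "(\<lambda>(t, x). \<kappa> x * pt (t, x)) = (\<lambda>p. (case p of (t, x) \<Rightarrow> \<kappa> x) * pt p)"
      by (auto simp: fun_eq_iff)
    then show ?thesis using I3 by (simp only:)
  qed
  have "(LINT (t, x):{0<..} \<times> UNIV|lebesgue. w t x * pt (t, x) + G t x * px (t, x))
      = (LINT p:{0<..} \<times> UNIV|lebesgue. (case p of (t, x) \<Rightarrow> Q (Y x - t) * (pt (t, x) / c x + px (t, x))) + (case p of (t, x) \<Rightarrow> \<kappa> x * pt (t, x)))"
    using half_plane_sets by (intro set_lebesgue_integral_cong) (auto simp: w G algebra_simps)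
  also have "\<dots> = (LINT (t, x):{0<..} \<times> UNIV|lebesgue. Q (Y x - t) * (pt (t, x) / c x + px (t, x)))
      + (LINT (t, x):{0<..} \<times> UNIV|lebesgue. \<kappa> x * pt (t, x))"
    unfolding half_plane_integral by (rule Bochner_Integration.integral_add[OF I12 I3'])
  finally have 1: "(LINT (t, x):{0<..} \<times> UNIV|lebesgue. w t x * pt (t, x) + G t x * px (t, x)) = \<dots>" .
  have J: "integrable lebesgue (\<lambda>x. v x * \<phi> (0, x))"
    if v [measurable]: "v \<in> borel_measurable borel" and b: "\<forall>x\<in>{-R..R}. \<bar>v x\<bar> \<le> L" for v L
  proof (rule bounded_box_integrable[where S = "{-R..R}" and B = "\<bar>L\<bar> * M"])
    have "continuous_on UNIV (\<lambda>x. \<phi> (0, x))"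
      by (rule continuous_on_compose2[OF cont(1)]) (auto intro!: continuous_on_Pair continuous_on_const continuous_on_id)
    then have "(\<lambda>x. \<phi> (0, x)) \<in> borel_measurable borel" by (rule borel_measurable_continuous_onI)
    then show "(\<lambda>x. v x * \<phi> (0, x)) \<in> borel_measurable lebesgue"
      by (intro measurable_completion) simp
    show zero: "v x * \<phi> (0, x) = 0" if "x \<notin> {-R..R}" for x
    proof -
      have "R \<le> \<bar>x\<bar>" using that by auto
      then show ?thesis using far by simp
    qed
    show "AE x in lebesgue. \<bar>v x * \<phi> (0, x)\<bar> \<le> \<bar>L\<bar> * M"
    proof (rule AE_I2)
      fix x
      have "0 \<le> M" using bd[of "(0, x)"] by linarith
      moreover have "\<bar>v x * \<phi> (0, x)\<bar> \<le> \<bar>L\<bar> * M" if "x \<in> {-R..R}"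
      proof -
        have "\<bar>v x\<bar> \<le> L" using b that by blast
        then show ?thesis unfolding abs_mult using bd[of "(0, x)"] by (intro mult_mono) auto
      qed
      ultimately show "\<bar>v x * \<phi> (0, x)\<bar> \<le> \<bar>L\<bar> * M" using zero[of x] by (cases "x \<in> {-R..R}") auto
    qed
  qed auto
  have 2: "(LINT x|lebesgue. w0 x * \<phi> (0, x)) = (LINT x|lebesgue. Q (Y x) / c x * \<phi> (0, x)) + (LINT x|lebesgue. \<kappa> x * \<phi> (0, x))"
    unfolding w0 distrib_right using Qc K
    by (intro Bochner_Integration.integral_add J[where L = "B / c x0"] J[where L = K]) auto
  show ?thesis
    using transport_identity[OF \<phi> Q QB] test_function_stationary[OF \<phi> \<kappa> \<kappa>B]
    unfolding balance_def dt dx 1 2 by simp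
qed

end

section \<open>Entropy inequalities for the transported datum\<close>

lemma locally_bounded_over_coef: "\<exists>B. \<forall>x\<in>{-R..R}. \<bar>1 / coef x\<bar> \<le> B"
proof (intro exI ballI)
  fix x assume "x \<in> {-R..R}"
  then have "(\<rho> (-R))\<^sup>2 \<le> (\<rho> x)\<^sup>2" using \<rho>_pos[of "-R"] by (intro power_mono \<rho>_mono) auto
  then have "(\<rho> (-R))\<^sup>2 \<le> coef x" using coef_bounds(1)[of x] by linarith
  then show "\<bar>1 / coef x\<bar> \<le> 1 / (\<rho> (-R))\<^sup>2"
    using \<rho>_pos[of "-R"] coef_pos[of x] by (simp add: frac_le)
qed

text \<open>The zero set of the flux is {0}, so the class for alpha = 0 collapses to the zero
  function, which is \<open>k_plus\<close> at 0. The recorded strict inequality makes the negative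
  branch strictly negative.\<close>

lemma flux_stationary_states:
  assumes "k \<in> stationary_states flux (\<lambda>_. 0) (\<lambda>_. 0) \<alpha>" "0 \<le> \<alpha>"
  shows "k = k_plus flux (\<lambda>_. 0) \<alpha> \<or> 0 < \<alpha> \<and> k = (\<lambda>x. - k_plus flux (\<lambda>_. 0) \<alpha> x)"
proof (cases "\<alpha> = 0")
  case True
  then have "k = (\<lambda>_. 0)" using assms by (auto simp: stationary_states_def intro: antisym)
  moreover have "k_plus flux (\<lambda>_. 0) 0 = (\<lambda>_. 0)"
    using coef_pos by (simp add: flux_k_plus less_imp_le)
  ultimately show ?thesis using True by simp
next
  case False
  then show ?thesis using assms by (auto simp: stationary_states_def flux_k_minus)
qed

lemma flux_k_plus_le:
  assumes "0 \<le> \<alpha>"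
  shows "k_plus flux (\<lambda>_. 0) \<alpha> x \<le> \<alpha> + 1"
proof -
  have "\<alpha> \<le> coef x \<Longrightarrow> \<alpha> / coef x \<le> 1" using coef_pos[of x] by simp
  moreover have "(\<alpha> + 1) / (1 + coef x) \<le> \<alpha> + 1"
    using coef_pos[of x] assms by (simp add: divide_le_eq)
  ultimately show ?thesis using assms by (auto simp: flux_k_plus)
qed

lemma flux_k_plus_measurable:
  assumes "0 \<le> \<alpha>"
  shows "k_plus flux (\<lambda>_. 0) \<alpha> \<in> borel_measurable borel"
proof -
  have [measurable]: "coef \<in> borel_measurable borel" using coef_cont by (rule borel_measurable_continuous_onI)
  show ?thesis unfolding flux_k_plus[OF assms] by measurable
qed

text \<open>\<open>coef\<close> times the solution is constant along characteristics. As the values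
  stay in [0,1], the flux is linear there and equals the transported quantity W, so each entropy
  inequality holds with equality by \<open>transport_balance\<close>.\<close>

theorem transported_datum_solves:
  assumes "characteristics coef Y X"
  defines "u \<equiv> \<lambda>t x. coef (X (Y x - t)) * datum (X (Y x - t)) / coef x"
  shows "adapted_entropy_solution flux (\<lambda>_. 0) (\<lambda>_. 0) datum u"
proof -
  interpret characteristics coef Y X by fact
  define W where "W z = coef (X z) * datum (X z)" for z
  have u: "u t x = W (Y x - t) / coef x" for t x by (simp add: u_def W_def)
  have W_meas [measurable]: "W \<in> borel_measurable borel" unfolding W_def by measurable
  have W_nonneg: "0 \<le> W z" for z
    using coef_pos[of "X z"] datum_nonneg by (simp add: W_def)
  have W_le_1: "W z \<le> 1" for z
  proof -
    have "W z \<le> 3 * (1/3)"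
      unfolding W_def by (intro mult_mono coef_le_3 datum_le datum_nonneg) simp
    then show ?thesis by simp
  qed
  \<comment> \<open>The foot of the characteristic lies to the left of x, so the loss of a factor 3
    is compensated by the datum being at most 1/3.\<close>
  have W_le: "W (Y x - t) \<le> coef x" if "0 \<le> t" for x t
  proof -
    have "X (Y x - t) \<le> x" using monoD[OF mono_X, of "Y x - t" "Y x"] that by (simp add: XY)
    then have "W (Y x - t) \<le> (3 * coef x) * (1/3)"
      unfolding W_def using coef_pos[of x] by (intro mult_mono coef_le_3_coef datum_le datum_nonneg) auto
    then show ?thesis by simp
  qed
  have u_bounds: "0 \<le> u t x" "u t x \<le> 1" if "0 \<le> t" for t x
    using W_le[OF that, of x] W_nonneg[of "Y x - t"] coef_pos[of x] by (auto simp: u)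
  have u_meas: "case_prod u \<in> borel_measurable borel"
    unfolding u borel_prod[symmetric] by measurable
  have Linf: "case_prod u \<in> Linf half_plane"
    unfolding Linf_def
  proof (intro CollectI conjI exI[of _ 1] AE_I2 borel_imp_half_plane_measurable u_meas)
    fix p assume "p \<in> space half_plane"
    then obtain t x where "p = (t, x)" "0 < t" by (cases p) (auto simp: space_restrict_space)
    then show "\<bar>case_prod u p\<bar> \<le> 1" using u_bounds[of t x] by auto
  qed
  have slice_meas [measurable]: "u t \<in> borel_measurable borel" for t
    unfolding u by measurable
  have slice_int: "integrable lebesgue (\<lambda>x. indicator K x *\<^sub>R u t x)" if K: "compact K" "0 \<le> t" for K t
  proof (rule bounded_box_integrable[where S = K and B = 1])
    have [measurable]: "K \<in> sets borel" using K by (blast intro: borel_compact)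
    show "(\<lambda>x. indicator K x *\<^sub>R u t x) \<in> borel_measurable lebesgue"
      by (intro measurable_completion) measurable
    show "AE x in lebesgue. \<bar>indicator K x *\<^sub>R u t x\<bar> \<le> 1"
      using u_bounds[OF K(2)] by (intro AE_I2) (auto simp: indicator_def)
  qed (use K in \<open>auto intro: compact_imp_bounded\<close>)
  have "C_L1loc T u" for T
    unfolding C_L1loc_def
  proof (intro allI impI conjI ballI)
    fix K :: "real set" and s assume K: "compact K" and s: "s \<in> {0..T}"
    show "u t absolutely_integrable_on K" if "t \<in> {0..T}" for t
      using slice_int[OF K, of t] that by (simp add: set_integrable_def)
    have [measurable]: "K \<in> sets borel" using K by (blast intro: borel_compact)
    \<comment> \<open>W is continuous except over the countably many discontinuities of the datum,
      so at almost every x the solution is continuous in time at s and dominated convergence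
      applies.\<close>
    have ae: "AE x in lebesgue. isCont W (Y x - s)"
    proof -
      have "{x. \<not> isCont W (Y x - s)} \<subseteq> (\<lambda>x. X (Y x + s)) ` {x. \<not> isCont datum x}"
      proof
        fix x assume "x \<in> {x. \<not> isCont W (Y x - s)}"
        then have "\<not> isCont W (Y x - s)" by simp
        moreover have "isCont W z" if "isCont datum (X z)" for z
        proof -
          have "isCont coef (X z)" using coef_cont by (simp add: continuous_on_eq_continuous_at)
          then show ?thesis
            unfolding W_def[abs_def] by (intro continuous_mult isCont_o2[OF X_cont] that)
        qed
        ultimately have "\<not> isCont datum (X (Y x - s))" by blast
        then show "x \<in> (\<lambda>x. X (Y x + s)) ` {x. \<not> isCont datum x}"
          by (intro image_eqI[of _ _ "X (Y x - s)"]) (simp_all add: YX XY)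
      qed
      then have "countable {x. \<not> isCont W (Y x - s)}"
        using countable_datum_discont by (meson countable_image countable_subset)
      then have "{x. \<not> isCont W (Y x - s)} \<in> null_sets lborel" by (rule countable_imp_null_set_lborel)
      then have "AE x in lborel. isCont W (Y x - s)" by (rule AE_I') auto
      then show ?thesis by (rule AE_completion)
    qed
    show "((\<lambda>t. LINT x:K|lebesgue. \<bar>u t x - u s x\<bar>) \<longlongrightarrow> 0) (at s within {0..T})"
      unfolding tendsto_at_iff_sequentially
    proof (intro allI impI)
      fix \<sigma> :: "nat \<Rightarrow> real" assume \<sigma>: "\<forall>i. \<sigma> i \<in> {0..T} - {s}" "\<sigma> \<longlonglongrightarrow> s"
      have "(\<lambda>i. LINT x|lebesgue. indicator K x *\<^sub>R \<bar>u (\<sigma> i) x - u s x\<bar>) \<longlonglongrightarrow> (LINT x|(lebesgue :: real measure). (0::real))"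
      proof (rule integral_dominated_convergence[where w = "\<lambda>x. indicator K x"])
        show "(\<lambda>x. indicator K x *\<^sub>R \<bar>u (\<sigma> i) x - u s x\<bar>) \<in> borel_measurable lebesgue" for i
          by (intro measurable_completion) measurable
        show "integrable lebesgue (indicator K :: real \<Rightarrow> real)"
          using emeasure_compact_finite[OF K] by (intro integrable_real_indicator) auto
        show "AE x in lebesgue. norm (indicator K x *\<^sub>R \<bar>u (\<sigma> i) x - u s x\<bar>) \<le> indicator K x" for i
        proof (rule AE_I2)
          fix x
          have "0 \<le> \<sigma> i" "0 \<le> s" using \<sigma>(1) s by auto
          then have "\<bar>u (\<sigma> i) x - u s x\<bar> \<le> 1" using u_bounds[of "\<sigma> i" x] u_bounds[of s x] by linarith
          then show "norm (indicator K x *\<^sub>R \<bar>u (\<sigma> i) x - u s x\<bar>) \<le> indicator K x" by (simp add: indicator_def)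
        qed
        show "AE x in lebesgue. (\<lambda>i. indicator K x *\<^sub>R \<bar>u (\<sigma> i) x - u s x\<bar>) \<longlonglongrightarrow> 0"
          using ae
        proof (rule eventually_mono)
          fix x assume "isCont W (Y x - s)"
          then have "(\<lambda>i. W (Y x - \<sigma> i)) \<longlonglongrightarrow> W (Y x - s)"
            by (rule isCont_tendsto_compose) (intro tendsto_intros \<sigma>)
          then have "(\<lambda>i. indicator K x *\<^sub>R \<bar>W (Y x - \<sigma> i) / coef x - W (Y x - s) / coef x\<bar>)
              \<longlonglongrightarrow> indicator K x *\<^sub>R \<bar>W (Y x - s) / coef x - W (Y x - s) / coef x\<bar>"
            using coef_pos[of x] by (intro tendsto_intros) auto
          then show "(\<lambda>i. indicator K x *\<^sub>R \<bar>u (\<sigma> i) x - u s x\<bar>) \<longlonglongrightarrow> 0" by (simp add: u)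
        qed
      qed auto
      then show "((\<lambda>t. LINT x:K|lebesgue. \<bar>u t x - u s x\<bar>) \<circ> \<sigma>) \<longlonglongrightarrow> 0"
        by (simp add: set_lebesgue_integral_def o_def)
    qed
  qed
  moreover have "balance (\<lambda>t x. \<bar>u t x - k x\<bar>) (\<lambda>t x. sgn (u t x - k x) * (flux x (u t x) - \<alpha>)) (\<lambda>x. \<bar>datum x - k x\<bar>) \<phi> = 0"
    if \<alpha>: "0 \<le> \<alpha>" and k: "k \<in> stationary_states flux (\<lambda>_. 0) (\<lambda>_. 0) \<alpha>" and \<phi>: "\<phi> \<in> test_functions" for \<alpha> k \<phi>
  proof -
    define kp where "kp = k_plus flux (\<lambda>_. 0) \<alpha>"
    have [measurable]: "kp \<in> borel_measurable borel" unfolding kp_def using \<alpha> by (rule flux_k_plus_measurable)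
    have kp: "0 \<le> kp x" "kp x \<le> \<alpha> + 1" for x unfolding kp_def using flux_k_plus_nonneg[OF \<alpha>] flux_k_plus_le[OF \<alpha>] by auto
    have kp_eq: "kp x = (if \<alpha> \<le> coef x then \<alpha> / coef x else (\<alpha> + 1) / (1 + coef x))" for x
      unfolding kp_def flux_k_plus[OF \<alpha>] ..
    have loc: "\<exists>B. \<forall>x\<in>{-R..R}. \<bar>kp x\<bar> + \<alpha> * \<bar>1 / coef x\<bar> \<le> B" for R
    proof -
      obtain B where B: "\<forall>x\<in>{-R..R}. \<bar>1 / coef x\<bar> \<le> B" using locally_bounded_over_coef by blast
      have "\<bar>kp x\<bar> + \<alpha> * \<bar>1 / coef x\<bar> \<le> (\<alpha> + 1) + \<alpha> * B" if "x \<in> {-R..R}" for x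
        using B that \<alpha> kp[of x] by (intro add_mono mult_left_mono) auto
      then show ?thesis by blast
    qed
    have flux_u: "flux x (u t x) = W (Y x - t)" if "0 \<le> t" for t x
    proof -
      have "flux x (u t x) = coef x * u t x" using u_bounds[OF that, of x] by (simp add: flux_def)
      then show ?thesis using coef_pos[of x] by (simp add: u)
    qed
    have u0: "u 0 x = datum x" for x using coef_pos[of x] by (simp add: u W_def XY)
    from flux_stationary_states[OF k \<alpha>] consider "k = kp" | "0 < \<alpha>" "k = (\<lambda>x. - kp x)"
      unfolding kp_def by blast
    then show ?thesis
    proof cases
      case 1
      \<comment> \<open>Where alpha <= coef x, the state is alpha/coef x and everything is linear.
        Elsewhere kp > 1 >= u and W < alpha, so all signs are negative, and the correction kp -
        alpha/coef x is stationary.\<close>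
      have abs_eq: "\<bar>u t x - kp x\<bar> = \<bar>W (Y x - t) - \<alpha>\<bar> / coef x + (kp x - \<alpha> / coef x)"
        and flux_eq: "sgn (u t x - kp x) * (flux x (u t x) - \<alpha>) = \<bar>W (Y x - t) - \<alpha>\<bar>" if "0 \<le> t" for t x
      proof -
        have c: "0 < coef x" by (rule coef_pos)
        have "\<bar>u t x - kp x\<bar> = \<bar>W (Y x - t) - \<alpha>\<bar> / coef x + (kp x - \<alpha> / coef x) \<and>
          sgn (u t x - kp x) * (flux x (u t x) - \<alpha>) = \<bar>W (Y x - t) - \<alpha>\<bar>"
        proof (cases "\<alpha> \<le> coef x")
          case True
          then have "u t x - kp x = (W (Y x - t) - \<alpha>) / coef x" by (simp add: u kp_eq diff_divide_distrib)
          with c True show ?thesis by (simp add: kp_eq flux_u[OF that] abs_divide sgn_divide abs_sgn mult.commute)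
        next
          case False
          then have "1 < kp x" using c by (simp add: kp_eq)
          then have "u t x < kp x" using u_bounds[OF that, of x] by linarith
          moreover have "W (Y x - t) < \<alpha>" using False W_le[OF that, of x] by linarith
          moreover have "\<bar>W (Y x - t) - \<alpha>\<bar> / coef x = \<alpha> / coef x - u t x"
            using \<open>W (Y x - t) < \<alpha>\<close> by (simp add: u diff_divide_distrib)
          ultimately show ?thesis by (simp add: flux_u[OF that])
        qed
        then show "\<bar>u t x - kp x\<bar> = \<bar>W (Y x - t) - \<alpha>\<bar> / coef x + (kp x - \<alpha> / coef x)"
          "sgn (u t x - kp x) * (flux x (u t x) - \<alpha>) = \<bar>W (Y x - t) - \<alpha>\<bar>" by auto
      qed
      show ?thesis
        unfolding 1
      proof (rule transport_balance[OF \<phi>, where Q = "\<lambda>z. \<bar>W z - \<alpha>\<bar>" and \<kappa> = "\<lambda>x. kp x - \<alpha> / coef x" and B = "1 + \<alpha>"])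
        show "\<bar>\<bar>W z - \<alpha>\<bar>\<bar> \<le> 1 + \<alpha>" for z using W_nonneg[of z] W_le_1[of z] \<alpha> by auto
        show "\<exists>B. \<forall>x\<in>{-R..R}. \<bar>kp x - \<alpha> / coef x\<bar> \<le> B" for R
        proof -
          have "\<bar>kp x - \<alpha> / coef x\<bar> \<le> \<bar>kp x\<bar> + \<alpha> * \<bar>1 / coef x\<bar>" for x
            using \<alpha> abs_triangle_ineq4[of "kp x" "\<alpha> / coef x"] by (simp add: abs_divide)
          then show ?thesis using loc[of R] order_trans by blast
        qed
        show "\<bar>datum x - kp x\<bar> = \<bar>W (Y x) - \<alpha>\<bar> / coef x + (kp x - \<alpha> / coef x)" for x
          using abs_eq[of 0 x] by (simp add: u0)
      qed (simp_all add: abs_eq flux_eq)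
    next
      case 2
      \<comment> \<open>With u above the negative state, the absolute value is affine in u and the
        sign is 1.\<close>
      have pos: "0 < u t x + kp x" if "0 \<le> t" for t x
      proof -
        have "0 < kp x" using 2(1) coef_pos[of x] by (auto simp: kp_eq intro!: divide_pos_pos)
        then show ?thesis using u_bounds(1)[OF that, of x] by linarith
      qed
      have abs_eq: "\<bar>u t x + kp x\<bar> = (W (Y x - t) - \<alpha>) / coef x + (kp x + \<alpha> / coef x)" if "0 \<le> t" for t x
        using pos[OF that, of x] by (simp add: u diff_divide_distrib)
      show ?thesis
        unfolding 2(2) minus_minus diff_minus_eq_add
      proof (rule transport_balance[OF \<phi>, where Q = "\<lambda>z. W z - \<alpha>" and \<kappa> = "\<lambda>x. kp x + \<alpha> / coef x" and B = "1 + \<alpha>"])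
        show "\<bar>W z - \<alpha>\<bar> \<le> 1 + \<alpha>" for z using W_nonneg[of z] W_le_1[of z] \<alpha> by auto
        show "\<exists>B. \<forall>x\<in>{-R..R}. \<bar>kp x + \<alpha> / coef x\<bar> \<le> B" for R
        proof -
          have "\<bar>kp x + \<alpha> / coef x\<bar> \<le> \<bar>kp x\<bar> + \<alpha> * \<bar>1 / coef x\<bar>" for x
            using \<alpha> abs_triangle_ineq[of "kp x" "\<alpha> / coef x"] by (simp add: abs_divide)
          then show ?thesis using loc[of R] order_trans by blast
        qed
        show "\<bar>datum x + kp x\<bar> = (W (Y x) - \<alpha>) / coef x + (kp x + \<alpha> / coef x)" for x
          using abs_eq[of 0 x] by (simp add: u0)
        show "sgn (u t x + kp x) * (flux x (u t x) - \<alpha>) = W (Y x - t) - \<alpha>" if "0 < t" for t x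
          using pos[of t x] that by (simp add: flux_u)
      qed (simp_all add: abs_eq)
    qed
  qed
  ultimately show ?thesis
    unfolding adapted_entropy_solution_def balance_def using Linf by (simp add: case_prod_beta)
qed

section \<open>Determinacy of adapted entropy solutions\<close>

lemma entropy_pair_Linf:
  assumes u: "case_prod u \<in> Linf half_plane" and k [measurable]: "k \<in> borel_measurable borel" and "\<And>x. \<bar>k x\<bar> \<le> B"
  shows "case_prod (\<lambda>t x. \<bar>u t x - k x\<bar>) \<in> Linf half_plane"
    and "case_prod (\<lambda>t x. sgn (u t x - k x) * (flux x (u t x) - \<alpha>)) \<in> Linf half_plane"
proof -
  obtain C where m [measurable]: "case_prod u \<in> borel_measurable half_plane" and C: "AE p in half_plane. \<bar>case_prod u p\<bar> \<le> C"
    using u unfolding Linf_def by blast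
  have snd: "snd \<in> borel_measurable (borel :: (real \<times> real) measure)"
    by (intro borel_measurable_continuous_onI continuous_on_snd continuous_on_id)
  have [measurable]: "(\<lambda>p. k (snd p)) \<in> borel_measurable half_plane"
    by (intro borel_imp_half_plane_measurable measurable_compose[OF snd] k)
  have [measurable]: "(\<lambda>p. coef (snd p)) \<in> borel_measurable half_plane"
    by (intro borel_imp_half_plane_measurable measurable_compose[OF snd] borel_measurable_continuous_onI coef_cont)
  have "(\<lambda>p. \<bar>case_prod u p - k (snd p)\<bar>) \<in> borel_measurable half_plane"
    "(\<lambda>p. sgn (case_prod u p - k (snd p)) * (coef (snd p) * \<bar>case_prod u p\<bar> + max 0 (\<bar>case_prod u p\<bar> - 1) - \<alpha>)) \<in> borel_measurable half_plane"
    by measurable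
  moreover have "AE p in half_plane. \<bar>\<bar>case_prod u p - k (snd p)\<bar>\<bar> \<le> C + B"
    using C
  proof (rule eventually_mono)
    show "\<bar>case_prod u p\<bar> \<le> C \<Longrightarrow> \<bar>\<bar>case_prod u p - k (snd p)\<bar>\<bar> \<le> C + B" for p
      using assms(3)[of "snd p"] by linarith
  qed
  moreover have "AE p in half_plane. \<bar>sgn (case_prod u p - k (snd p)) * (flux (snd p) (case_prod u p) - \<alpha>)\<bar> \<le> 4 * C + \<bar>\<alpha>\<bar>"
    using C
  proof (rule eventually_mono)
    fix p assume "\<bar>case_prod u p\<bar> \<le> C"
    then have "\<bar>flux (snd p) (case_prod u p) - \<alpha>\<bar> \<le> 4 * C + \<bar>\<alpha>\<bar>"
      using flux_Lipschitz[of "snd p" "case_prod u p" 0] by simp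
    then show "\<bar>sgn (case_prod u p - k (snd p)) * (flux (snd p) (case_prod u p) - \<alpha>)\<bar> \<le> 4 * C + \<bar>\<alpha>\<bar>"
      by (auto simp: abs_mult abs_sgn_eq)
  qed
  ultimately show "case_prod (\<lambda>t x. \<bar>u t x - k x\<bar>) \<in> Linf half_plane"
    "case_prod (\<lambda>t x. sgn (u t x - k x) * (flux x (u t x) - \<alpha>)) \<in> Linf half_plane"
    unfolding Linf_def case_prod_beta flux_def by blast+
qed

lemma bounded_borel_Linf:
  fixes f :: "real \<Rightarrow> real"
  assumes "f \<in> borel_measurable borel" "\<And>x. \<bar>f x\<bar> \<le> B"
  shows "f \<in> Linf lebesgue"
  unfolding Linf_def using assms by (auto intro!: measurable_completion)

lemma datum_Linf: "datum \<in> Linf lebesgue"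
  using datum_nonneg datum_le by (intro bounded_borel_Linf[where B = "1/3"]) auto

context
  fixes u :: "real \<Rightarrow> real \<Rightarrow> real"
  assumes sol: "adapted_entropy_solution flux (\<lambda>_. 0) (\<lambda>_. 0) datum u"
begin

lemma solution_Linf: "case_prod u \<in> Linf half_plane"
  using sol by (simp add: adapted_entropy_solution_def)

lemma solution_entropy:
  assumes "0 \<le> \<alpha>" "\<phi> \<in> test_functions"
  shows "0 \<le> balance (\<lambda>t x. \<bar>u t x - k_plus flux (\<lambda>_. 0) \<alpha> x\<bar>)
    (\<lambda>t x. sgn (u t x - k_plus flux (\<lambda>_. 0) \<alpha> x) * (flux x (u t x) - \<alpha>))
    (\<lambda>x. \<bar>datum x - k_plus flux (\<lambda>_. 0) \<alpha> x\<bar>) \<phi>"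
proof -
  have "k_plus flux (\<lambda>_. 0) \<alpha> \<in> stationary_states flux (\<lambda>_. 0) (\<lambda>_. 0) \<alpha>"
    using coef_pos by (auto simp: stationary_states_def flux_k_plus less_imp_le)
  then show ?thesis
    using sol assms unfolding adapted_entropy_solution_def balance_def by blast
qed

text \<open>
  The entropy inequality for a \<open>k\<^sub>\<alpha>\<^sup>+\<close> lying above \<open>u\<close> is one half of the weak equation; added to the
  one for \<open>k = 0\<close> it controls the negative part of \<open>u\<close>.
\<close>

lemma solution_nonneg:
  assumes "0 < T"
  shows "AE (t, x) in half_plane. t < T \<and> a < x \<and> x < b - 4 * t \<longrightarrow> 0 \<le> u t x"
proof -
  obtain C0 where "AE p in half_plane. \<bar>case_prod u p\<bar> \<le> C0"
    using solution_Linf unfolding Linf_def by blast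
  then have C: "AE p in half_plane. \<bar>case_prod u p\<bar> \<le> \<bar>C0\<bar>" by (rule eventually_mono) simp
  \<comment> \<open>Large enough that K >= |C0| + 1 > |u| almost everywhere: alpha exceeds
    \<open>coef\<close>, and then K = (alpha + 1)/(1 + coef x) with denominator at most 4.\<close>
  define \<alpha> where "\<alpha> = 4 * \<bar>C0\<bar> + 4"
  have \<alpha>: "0 \<le> \<alpha>" by (simp add: \<alpha>_def)
  define K where "K = k_plus flux (\<lambda>_. 0) \<alpha>"
  have K_meas [measurable]: "K \<in> borel_measurable borel" unfolding K_def by (rule flux_k_plus_measurable[OF \<alpha>])
  have K_bounds: "0 \<le> K x" "K x \<le> \<alpha> + 1" for x unfolding K_def using flux_k_plus_nonneg[OF \<alpha>] flux_k_plus_le[OF \<alpha>] by auto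
  have K_large: "\<bar>C0\<bar> + 1 \<le> K x" for x
  proof -
    have "\<not> \<alpha> \<le> coef x" using coef_le_3[of x] by (simp add: \<alpha>_def)
    then have "K x = (\<alpha> + 1) / (1 + coef x)" by (simp add: K_def flux_k_plus[OF \<alpha>])
    moreover have "(\<bar>C0\<bar> + 1) * (1 + coef x) \<le> (\<bar>C0\<bar> + 1) * 4"
      using coef_le_3[of x] by (intro mult_left_mono) auto
    ultimately show ?thesis using coef_pos[of x] by (simp add: \<alpha>_def le_divide_eq algebra_simps)
  qed
  define w1 G1 where "w1 = (\<lambda>t x. \<bar>u t x - 0\<bar>)" and "G1 = (\<lambda>t x. sgn (u t x - 0) * (flux x (u t x) - 0))"
  define w2 G2 where "w2 = (\<lambda>t x. \<bar>u t x - K x\<bar>)" and "G2 = (\<lambda>t x. sgn (u t x - K x) * (flux x (u t x) - \<alpha>))"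
  \<comment> \<open>Where |u| <= |C0|, the density is |u| - u, twice the negative part of u;
    subtracting K and alpha costs nothing, as the pair (K, alpha) has balance 0.\<close>
  define w G where "w t x = w1 t x + w2 t x - K x" and "G t x = G1 t x + G2 t x - \<alpha>" for t x
  have k0: "k_plus flux (\<lambda>_. 0) 0 = (\<lambda>_. 0)"
    using coef_pos by (simp add: flux_k_plus less_imp_le)
  have L1: "case_prod w1 \<in> Linf half_plane" "case_prod G1 \<in> Linf half_plane"
    unfolding w1_def G1_def by (rule entropy_pair_Linf[OF solution_Linf, where B = 0]; simp)+
  have L2: "case_prod w2 \<in> Linf half_plane" "case_prod G2 \<in> Linf half_plane"
    unfolding w2_def G2_def using K_bounds \<alpha>
    by (intro entropy_pair_Linf[OF solution_Linf K_meas, where B = "\<alpha> + 1"]; simp)+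
  have snd: "snd \<in> borel_measurable (borel :: (real \<times> real) measure)"
    by (intro borel_measurable_continuous_onI continuous_on_snd continuous_on_id)
  have KL: "case_prod (\<lambda>t x. K x) \<in> Linf half_plane" "case_prod (\<lambda>t x. - K x) \<in> Linf half_plane"
    unfolding Linf_def case_prod_beta using K_bounds \<alpha>
    by (auto intro!: exI[of _ "\<alpha> + 1"] borel_imp_half_plane_measurable measurable_compose[OF snd] AE_I2 simp: abs_le_iff)
      (use K_bounds \<alpha> in \<open>smt (verit)\<close>)+
  have AL: "case_prod (\<lambda>t x. c) \<in> Linf half_plane" for c :: real
    unfolding Linf_def case_prod_beta by auto
  have wG: "case_prod w \<in> Linf half_plane" "case_prod G \<in> Linf half_plane"
  proof -
    have "case_prod w = (\<lambda>p. (case_prod w1 p + case_prod w2 p) + case_prod (\<lambda>t x. - K x) p)"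
      and "case_prod G = (\<lambda>p. (case_prod G1 p + case_prod G2 p) + case_prod (\<lambda>t x. - \<alpha>) p)"
      by (auto simp: w_def G_def)
    then show "case_prod w \<in> Linf half_plane" "case_prod G \<in> Linf half_plane"
      using Linf_add[OF Linf_add[OF L1(1) L2(1)] KL(2)] Linf_add[OF Linf_add[OF L1(2) L2(2)] AL[of "- \<alpha>"]] by simp_all
  qed
  have dL: "(\<lambda>x. \<bar>datum x - 0\<bar>) \<in> Linf lebesgue" "K \<in> Linf lebesgue" "(\<lambda>x. \<bar>datum x - K x\<bar>) \<in> Linf lebesgue"
    "(\<lambda>_. 0) \<in> Linf (lebesgue :: real measure)"
  proof -
    have bd: "\<bar>datum x - 0\<bar> \<le> 1/3" "\<bar>K x\<bar> \<le> \<alpha> + 1" "\<bar>\<bar>datum x - K x\<bar>\<bar> \<le> \<alpha> + 2" for x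
      using datum_nonneg[of x] datum_le[of x] K_bounds[of x] by auto
    show "K \<in> Linf lebesgue" by (rule bounded_borel_Linf[OF K_meas bd(2)])
    show "(\<lambda>x. \<bar>datum x - 0\<bar>) \<in> Linf lebesgue"
      by (rule bounded_borel_Linf[where B = "1/3"]) (use bd(1) in auto)
    show "(\<lambda>x. \<bar>datum x - K x\<bar>) \<in> Linf lebesgue"
      by (rule bounded_borel_Linf[OF _ bd(3)]) measurable
    show "(\<lambda>_. 0) \<in> Linf (lebesgue :: real measure)"
      by (rule bounded_borel_Linf[where B = 0]) auto
  qed
  obtain Y X where "characteristics coef Y X" using characteristics_exist[OF coef_cont coef_pos coef_le_3] .
  then interpret characteristics coef Y X .
  have ent: "0 \<le> balance w G (\<lambda>_. 0) \<phi>" if \<phi>: "\<phi> \<in> test_functions" for \<phi>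
  proof -
    have "0 \<le> balance w1 G1 (\<lambda>x. \<bar>datum x - 0\<bar>) \<phi>"
      using solution_entropy[OF order_refl \<phi>] unfolding k0 w1_def G1_def .
    moreover have "0 \<le> balance w2 G2 (\<lambda>x. \<bar>datum x - K x\<bar>) \<phi>"
      using solution_entropy[OF \<alpha> \<phi>] unfolding w2_def G2_def K_def .
    moreover have "balance (\<lambda>t x. K x) (\<lambda>t x. \<alpha>) K \<phi> = 0"
    proof (rule transport_balance[OF \<phi>, where Q = "\<lambda>_. \<alpha>" and \<kappa> = "\<lambda>x. K x - \<alpha> / coef x" and B = \<alpha>])
      fix R
      obtain B where B: "\<forall>x\<in>{-R..R}. \<bar>1 / coef x\<bar> \<le> B" using locally_bounded_over_coef by blast
      have "\<bar>K x - \<alpha> / coef x\<bar> \<le> (\<alpha> + 1) + \<alpha> * B" if "x \<in> {-R..R}" for x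
      proof -
        have "\<bar>K x - \<alpha> / coef x\<bar> \<le> \<bar>K x\<bar> + \<alpha> * \<bar>1 / coef x\<bar>"
          using \<alpha> abs_triangle_ineq4[of "K x" "\<alpha> / coef x"] by (simp add: abs_divide)
        also have "\<dots> \<le> (\<alpha> + 1) + \<alpha> * B"
          using B that \<alpha> K_bounds[of x] by (intro add_mono mult_left_mono) auto
        finally show ?thesis .
      qed
      then show "\<exists>B. \<forall>x\<in>{-R..R}. \<bar>K x - \<alpha> / coef x\<bar> \<le> B" by blast
    qed (use \<alpha> in simp_all)
    moreover have "balance w1 G1 (\<lambda>x. \<bar>datum x - 0\<bar>) \<phi> + balance w2 G2 (\<lambda>x. \<bar>datum x - K x\<bar>) \<phi>
        = balance (\<lambda>t x. K x) (\<lambda>t x. \<alpha>) K \<phi> + balance w G (\<lambda>_. 0) \<phi>"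
    proof -
      \<comment> \<open>The datum lies between 0 and K, so the combined pair has initial value
        0.\<close>
      have "\<bar>datum x - 0\<bar> + \<bar>datum x - K x\<bar> = K x + 0" for x
        using datum_nonneg[of x] datum_le[of x] K_large[of x] by simp
      then show ?thesis
        unfolding balance_add[OF \<phi> L1(1) L2(1) L1(2) L2(2) dL(1,3), symmetric]
          balance_add[OF \<phi> KL(1) wG(1) AL wG(2) dL(2,4), symmetric]
        by (simp add: w_def G_def)
    qed
    ultimately show ?thesis by linarith
  qed
  have C': "AE p in half_plane. case p of (t, x) \<Rightarrow> \<bar>u t x\<bar> \<le> \<bar>C0\<bar>"
    using C by (simp add: case_prod_beta)
  have wG_eq: "w t x = \<bar>u t x\<bar> - u t x" "G t x = (if u t x < 0 then - 2 * flux x (u t x) else 0)" if "\<bar>u t x\<bar> \<le> \<bar>C0\<bar>" for t x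
    using that K_large[of x] by (auto simp: w_def G_def w1_def w2_def G1_def G2_def sgn_if)
  \<comment> \<open>Where u < 0, the pair is (2|u|, -2 flux) with flux between 0 and 4|u|: signals
    move left with speed at most 4.\<close>
  have "AE (t, x) in half_plane. t < T \<and> a + 0 * t < x \<and> x < b + (- 4) * t \<longrightarrow> w t x = 0"
  proof (rule domain_of_dependence[OF ent wG _ _ assms])
    show "AE (t, x) in half_plane. t < T \<and> a + 0 * t < x \<and> x < b + - 4 * t \<longrightarrow>
        0 \<le> w t x \<and> - 4 * w t x \<le> G t x \<and> G t x \<le> 0 * w t x"
      using C'
    proof eventually_elim
      case (elim p)
      obtain t x where p: "p = (t, x)" by (cases p)
      have "flux x (u t x) \<le> 4 * \<bar>u t x\<bar>" "0 \<le> flux x (u t x)"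
        using flux_Lipschitz[of x "u t x" 0] flux_nonneg[of x "u t x"] by auto
      then show ?case using elim by (auto simp: p wG_eq)
    qed
  qed auto
  with C' show ?thesis
  proof eventually_elim
    case (elim p)
    obtain t x where p: "p = (t, x)" by (cases p)
    show ?case using elim by (auto simp: p wG_eq)
  qed
qed

text \<open>The state k of level alpha agrees with the datum on [b-6, b], so |u - k| starts from 0
  there. Its signals move right with speed at least s, a lower bound for \<open>coef\<close> beyond
  b-6, and at most 4; hence the left edge of the cone has slope 4 and the right edge slope
  s.\<close>

lemma solution_in_cone:
  assumes b: "b = - 8 * real m" and \<alpha>: "\<alpha> = coef b * amp m" and s: "s = (1/4) ^ Suc m"
  shows "AE (t, x) in half_plane. t < 2 \<and> b - 6 + 4 * t < x \<and> x < b + s * t \<longrightarrow> u t x = \<alpha> / coef x"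
proof -
  define k where "k = k_plus flux (\<lambda>_. 0) \<alpha>"
  have amp: "amp m \<le> 1/3" using datum_launch[of m b] datum_le[of b] by (simp add: b)
  have \<alpha>0: "0 \<le> \<alpha>" using coef_pos[of b] amp_nonneg by (simp add: \<alpha>)
  have coef_plateau: "coef x = coef b" if "b - 6 \<le> x" "x \<le> b" for x
  proof -
    have "\<rho> x = \<rho> b" using that \<rho>_plateau[of m x] \<rho>_plateau[of m b] by (simp add: b)
    then show ?thesis by (simp add: coef_def)
  qed
  \<comment> \<open>The factor 3 is again offset by amp <= 1/3, which keeps k on the linear
    branch.\<close>
  have k_eq: "k x = \<alpha> / coef x" if "b - 6 \<le> x" for x
  proof -
    have "coef b \<le> 3 * coef x" 
      using coef_le_3_coef[of "b - 6" x] coef_plateau[of "b - 6"] that by simp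
    then have "coef b * amp m \<le> (3 * coef x) * (1/3)"
      using amp amp_nonneg coef_pos[of x] by (intro mult_mono) auto
    then have "\<alpha> \<le> coef x" by (simp add: \<alpha>)
    then show ?thesis by (simp add: k_def flux_k_plus[OF \<alpha>0])
  qed
  have coef_ge: "s \<le> coef x" if "b - 6 \<le> x" for x
  proof -
    have "(1/2) ^ Suc m \<le> \<rho> x" using \<rho>_mono[OF that] \<rho>_plateau[of m "b - 6"] by (simp add: b)
    then have "((1/2) ^ Suc m)\<^sup>2 \<le> (\<rho> x)\<^sup>2" by (intro power_mono) auto
    moreover have "((1/2::real) ^ Suc m)\<^sup>2 = ((1/2)\<^sup>2) ^ Suc m"
      by (simp only: power_mult[symmetric] mult.commute)
    moreover have "(1/2::real)\<^sup>2 = 1/4" by (simp add: power2_eq_square)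
    ultimately show ?thesis using coef_bounds(1)[of x] by (simp only: s)
  qed
  have s1: "0 < s" "s \<le> 1/4" unfolding s using power_le_one[of "1/4::real" m] by auto
  have k_nonneg: "0 \<le> k x" and k_le: "k x \<le> \<alpha> + 1" and k_meas: "k \<in> borel_measurable borel" for x
    unfolding k_def using flux_k_plus_nonneg[OF \<alpha>0] flux_k_plus_le[OF \<alpha>0] flux_k_plus_measurable[OF \<alpha>0] by auto
  have L: "case_prod (\<lambda>t x. \<bar>u t x - k x\<bar>) \<in> Linf half_plane"
    "case_prod (\<lambda>t x. sgn (u t x - k x) * (flux x (u t x) - \<alpha>)) \<in> Linf half_plane"
    using k_nonneg k_le by (intro entropy_pair_Linf[OF solution_Linf k_meas, where B = "\<alpha> + 1"]; simp)+
  have "AE (t, x) in half_plane. t < 2 \<and> (b - 6) + 4 * t < x \<and> x < b + s * t \<longrightarrow> \<bar>u t x - k x\<bar> = 0"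
  proof (rule domain_of_dependence[OF solution_entropy[OF \<alpha>0, folded k_def] L])
    show "\<bar>datum x - k x\<bar> = 0" if "x \<in> {b - 6..b}" for x
    proof -
      have "k x = amp m" using that k_eq[of x] coef_plateau[of x] coef_pos[of b] by (simp add: \<alpha>)
      moreover have "datum x = amp m" using that datum_launch[of m x] by (simp add: b)
      ultimately show ?thesis by simp
    qed
    \<comment> \<open>The flux increases only on nonnegative states, so the lower speed bound
      requires u >= 0. With 9 the region covers the cone up to time 2: there 9 - 4t > 1, whereas s t
      <= 1/2.\<close>
    have nn: "AE (t, x) in half_plane. t < 2 \<and> b - 6 < x \<and> x < b + 9 - 4 * t \<longrightarrow> 0 \<le> u t x"
      by (rule solution_nonneg) simp
    show "AE (t, x) in half_plane. t < 2 \<and> (b - 6) + 4 * t < x \<and> x < b + s * t \<longrightarrow>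
        0 \<le> \<bar>u t x - k x\<bar> \<and> s * \<bar>u t x - k x\<bar> \<le> sgn (u t x - k x) * (flux x (u t x) - \<alpha>) \<and>
        sgn (u t x - k x) * (flux x (u t x) - \<alpha>) \<le> 4 * \<bar>u t x - k x\<bar>"
      using half_plane_time_pos nn
    proof eventually_elim
      case (elim p)
      obtain t x where p: "p = (t, x)" by (cases p)
      show ?case unfolding p prod.case
      proof (intro impI)
        assume r: "t < 2 \<and> (b - 6) + 4 * t < x \<and> x < b + s * t"
        have t: "0 < t" using elim by (simp add: p)
        have "s * t \<le> 1/4 * 2" using s1 t r by (intro mult_mono) auto
        then have u0: "0 \<le> u t x" using elim r t by (simp add: p)
        have x: "b - 6 \<le> x" using r t by linarith
        have fk: "flux x (k x) = \<alpha>"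
          unfolding k_def by (rule flux_at_k_plus[OF \<alpha>0])
        have mono: "s * (v - y) \<le> flux x v - flux x y" if "0 \<le> y" "y \<le> v" for y v
        proof -
          have "s * (v - y) \<le> coef x * (v - y)" using coef_ge[OF x] that by (intro mult_right_mono) auto
          then show ?thesis using flux_mono[OF that, of x] by linarith
        qed
        have "sgn (u t x - k x) * (flux x (u t x) - \<alpha>) = \<bar>flux x (u t x) - flux x (k x)\<bar> \<and>
            s * \<bar>u t x - k x\<bar> \<le> \<bar>flux x (u t x) - flux x (k x)\<bar>"
        proof (cases "k x \<le> u t x")
          case True
          then have "0 \<le> s * (u t x - k x)" using s1 by simp
          then show ?thesis using mono[OF k_nonneg True] True fk by (auto simp: sgn_if)
        next
          case False
          then have "0 \<le> s * (k x - u t x)" using s1 by simp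
          then show ?thesis using mono[OF u0, of "k x"] False fk by (auto simp: sgn_if)
        qed
        then show "0 \<le> \<bar>u t x - k x\<bar> \<and> s * \<bar>u t x - k x\<bar> \<le> sgn (u t x - k x) * (flux x (u t x) - \<alpha>) \<and>
          sgn (u t x - k x) * (flux x (u t x) - \<alpha>) \<le> 4 * \<bar>u t x - k x\<bar>"
          using flux_Lipschitz[of x "u t x" "k x"] by simp
      qed
    qed
  qed auto
  with half_plane_time_pos show ?thesis
  proof eventually_elim
    case (elim p)
    obtain t x where p: "p = (t, x)" by (cases p)
    show ?case using elim k_eq[of x] by (auto simp: p)
  qed
qed

end

section \<open>From almost every point of the half plane to the slice at time 1\<close>

lemma AE_half_planeD:
  assumes "AE p in half_plane. P p"
  shows "AE t in lborel. 0 < t \<longrightarrow> (AE x in lebesgue. P (t, x))"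
proof -
  have "AE p in lebesgue. p \<in> {0<..} \<times> UNIV \<longrightarrow> P p"
    using assms half_plane_sets by (subst (asm) AE_restrict_space_iff) auto
  then have "AE p in lborel \<Otimes>\<^sub>M lborel. p \<in> {0<..} \<times> UNIV \<longrightarrow> P p"
    unfolding lborel_prod AE_completion_iff .
  from lborel_pair.AE_pair[OF this] show ?thesis
    by eventually_elim (auto dest: AE_completion)
qed

lemma AE_lborel_imp_ex_between:
  fixes a b :: real
  assumes ae: "AE t in lborel. P t" and "a < b"
  shows "\<exists>t. a < t \<and> t < b \<and> P t"
proof (rule ccontr)
  assume no: "\<not> ?thesis"
  obtain N where N: "{t \<in> space lborel. \<not> P t} \<subseteq> N" "N \<in> null_sets lborel"
    using ae by (auto elim!: AE_E3 simp: eventually_ae_filter)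
  have "{a<..<b} \<subseteq> N" using N(1) no by auto
  then have "emeasure lborel {a<..<b} = 0"
    using N(2) emeasure_mono[of "{a<..<b}" N lborel] by (auto simp: null_sets_def)
  then show False using \<open>a < b\<close> by simp
qed

text \<open>The cone result holds for almost every time only; continuity into L1 transfers it to
  time 1. All good times share one slice on [b, b+s], so the distance L to the slice at time 1 is
  constant along them; they accumulate at 1, where L tends to 0.\<close>

lemma solution_slice:
  assumes sol: "adapted_entropy_solution flux (\<lambda>_. 0) (\<lambda>_. 0) datum u"
    and b: "b = - 8 * real m" and \<alpha>: "\<alpha> = coef b * amp m" and s: "s = (1/4) ^ Suc m"
  shows "AE x in lebesgue. x \<in> {b..b + s} \<longrightarrow> u 1 x = \<alpha> / coef x"
proof -
  let ?K = "{b..b + s}"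
  have s1: "0 < s" unfolding s by simp
  define good where "good t \<longleftrightarrow> (AE x in lebesgue. x \<in> ?K \<longrightarrow> u t x = \<alpha> / coef x)" for t
  \<comment> \<open>For t > 1 the right edge b + s t lies strictly beyond b + s; for t < 5/4 the
    left edge is still below b - 1.\<close>
  have "AE t in lborel. 1 < t \<and> t < 5/4 \<longrightarrow> good t"
    using AE_half_planeD[OF solution_in_cone[OF sol b \<alpha> s]]
  proof (rule eventually_mono, intro impI)
    fix t :: real
    assume *: "0 < t \<longrightarrow> (AE x in lebesgue. case (t, x) of (t, x) \<Rightarrow> t < 2 \<and> b - 6 + 4 * t < x \<and> x < b + s * t \<longrightarrow> u t x = \<alpha> / coef x)"
      and t: "1 < t \<and> t < 5/4"
    then have "AE x in lebesgue. t < 2 \<and> b - 6 + 4 * t < x \<and> x < b + s * t \<longrightarrow> u t x = \<alpha> / coef x" by simp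
    then show "good t"
      unfolding good_def
    proof (rule eventually_mono)
      fix x assume **: "t < 2 \<and> b - 6 + 4 * t < x \<and> x < b + s * t \<longrightarrow> u t x = \<alpha> / coef x"
      have "s * 1 < s * t" using s1 t by (intro mult_strict_left_mono) auto
      then show "x \<in> ?K \<longrightarrow> u t x = \<alpha> / coef x" using ** t by auto
    qed
  qed
  then have ex: "\<exists>t. 1 < t \<and> t < 1 + d \<and> t < 5/4 \<and> good t" if "0 < d" for d
    using AE_lborel_imp_ex_between[of _ 1 "min (1 + d) (5/4)"] that by fastforce
  have C: "C_L1loc 2 u" using sol by (simp add: adapted_entropy_solution_def)
  then have abs_int: "u t absolutely_integrable_on ?K" if "t \<in> {0..2}" for t
    using that unfolding C_L1loc_def by blast
  have lim: "((\<lambda>t. LINT x:?K|lebesgue. \<bar>u t x - u 1 x\<bar>) \<longlongrightarrow> 0) (at 1 within {0..2})"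
    using C unfolding C_L1loc_def by auto
  define L where "L t = (LINT x:?K|lebesgue. \<bar>u t x - u 1 x\<bar>)" for t
  have int: "integrable lebesgue (\<lambda>x. indicator ?K x *\<^sub>R \<bar>u t x - u 1 x\<bar>)" if "t \<in> {0..2}" for t
  proof -
    have "integrable lebesgue (\<lambda>x. \<bar>indicator ?K x *\<^sub>R u t x - indicator ?K x *\<^sub>R u 1 x\<bar>)"
      using abs_int[OF that] abs_int[of 1] unfolding set_integrable_def by (intro integrable_abs Bochner_Integration.integrable_diff) auto
    also have "(\<lambda>x. \<bar>indicator ?K x *\<^sub>R u t x - indicator ?K x *\<^sub>R u 1 x\<bar>) = (\<lambda>x. indicator ?K x *\<^sub>R \<bar>u t x - u 1 x\<bar>)"
      by (auto simp: indicator_def)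
    finally show ?thesis .
  qed
  have L_eq: "L t = L t'" if "good t" "good t'" "t \<in> {0..2}" "t' \<in> {0..2}" for t t'
    unfolding L_def set_lebesgue_integral_def
  proof (rule integral_cong_AE)
    show "AE x in lebesgue. indicator ?K x *\<^sub>R \<bar>u t x - u 1 x\<bar> = indicator ?K x *\<^sub>R \<bar>u t' x - u 1 x\<bar>"
      using that(1,2) unfolding good_def by eventually_elim (auto simp: indicator_def)
  qed (use int[OF that(3)] int[OF that(4)] in auto)
  obtain t0 where t0: "1 < t0" "t0 < 5/4" "good t0" using ex[of 1] by auto
  have L_nonneg: "0 \<le> L t" for t
    unfolding L_def set_lebesgue_integral_def by (rule integral_nonneg_AE) (auto intro!: AE_I2)
  have "L t0 = 0"
  proof (rule ccontr)
    assume "L t0 \<noteq> 0"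
    then have pos: "0 < L t0" using L_nonneg[of t0] by simp
    obtain d where d: "0 < d" "\<And>t. t \<in> {0..2} \<Longrightarrow> t \<noteq> 1 \<Longrightarrow> dist t 1 < d \<Longrightarrow> L t < L t0"
      using order_tendstoD(2)[OF lim pos] unfolding eventually_at L_def[symmetric] by auto
    obtain t where t: "1 < t" "t < 1 + d" "t < 5/4" "good t" using ex[OF d(1)] by blast
    then have "L t < L t0" by (intro d(2)) (auto simp: dist_real_def)
    moreover have "L t = L t0" using t t0 by (intro L_eq) auto
    ultimately show False by simp
  qed
  then have "AE x in lebesgue. indicator ?K x *\<^sub>R \<bar>u t0 x - u 1 x\<bar> = 0"
    unfolding L_def set_lebesgue_integral_def
    by (subst (asm) integral_nonneg_eq_0_iff_AE) (use int[of t0] t0 in auto)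
  then show ?thesis
    using t0(3) unfolding good_def by eventually_elim (auto simp: indicator_def)
qed

section \<open>Blow-up of the total variation\<close>

text \<open>\<open>g\<close> may differ from \<open>f\<close> at the chosen points, so these are
  moved slightly to the right to points of agreement. The sums for \<open>f\<close> converge back by
  continuity.\<close>

lemma TV_ge_continuous:
  fixes f g :: "real \<Rightarrow> real"
  assumes cont: "continuous_on UNIV f"
    and ae: "AE x in lebesgue. x \<in> {l<..<r} \<longrightarrow> g x = f x"
    and n: "1 \<le> n" and mono: "strict_mono_on {1..Suc n} x"
    and x: "\<And>j. j \<in> {1..Suc n} \<Longrightarrow> x j \<in> {l<..<r}"
  shows "ereal (\<Sum>j=1..n. \<bar>f (x j) - f (x (Suc j))\<bar>) \<le> TV g"
proof -
  \<comment> \<open>Moved points stay below the next original point, or below r for the last one;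
    this preserves their order and keeps them inside the interval.\<close>
  define next_pt where "next_pt j = (if j = Suc n then r else x (Suc j))" for j
  have next_gt: "x j < next_pt j" and next_le: "next_pt j \<le> r" if "j \<in> {1..Suc n}" for j
    using that x[of j] x[of "Suc j"] strict_mono_onD[OF mono, of j "Suc j"] by (auto simp: next_pt_def)
  have ex: "\<exists>y. x j < y \<and> y < min (x j + 1 / real (Suc i)) (next_pt j) \<and> g y = f y" if "j \<in> {1..Suc n}" for i j
  proof -
    have "x j < min (x j + 1 / real (Suc i)) (next_pt j)" using next_gt[OF that] by simp
    from AE_lborel_imp_ex_between[OF ae[unfolded AE_completion_iff] this]
    obtain y where y: "x j < y" "y < min (x j + 1 / real (Suc i)) (next_pt j)" "y \<in> {l<..<r} \<longrightarrow> g y = f y" by blast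
    moreover have "y \<in> {l<..<r}" using y(1,2) x[OF that] next_le[OF that] by auto
    ultimately show ?thesis by blast
  qed
  define y where "y i j = (SOME y. x j < y \<and> y < min (x j + 1 / real (Suc i)) (next_pt j) \<and> g y = f y)" for i j
  have y: "x j < y i j \<and> y i j < min (x j + 1 / real (Suc i)) (next_pt j) \<and> g (y i j) = f (y i j)" if "j \<in> {1..Suc n}" for i j
    unfolding y_def using ex[OF that] by (rule someI_ex)
  have y_mono: "strict_mono_on {1..Suc n} (y i)" for i
  proof (rule strict_mono_onI)
    fix j k assume jk: "j \<in> {1..Suc n}" "k \<in> {1..Suc n}" "j < k"
    then have "y i j < x (Suc j)" using y[OF jk(1), of i] by (auto simp: next_pt_def)
    also have "x (Suc j) \<le> x k"
      using jk strict_mono_onD[OF mono, of "Suc j" k] by (cases "Suc j = k") auto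
    also have "x k < y i k" using y[OF jk(2), of i] by simp
    finally show "y i j < y i k" .
  qed
  have le: "ereal (\<Sum>j=1..n. \<bar>f (y i j) - f (y i (Suc j))\<bar>) \<le> TV g" for i
  proof -
    have "ereal (\<Sum>j=1..n. \<bar>g (y i j) - g (y i (Suc j))\<bar>) \<le> TV g"
      unfolding TV_def using y_mono[of i] n
      by (intro SUP_upper2[of "(n, y i)"]) (auto simp: chains_def)
    also have "(\<Sum>j=1..n. \<bar>g (y i j) - g (y i (Suc j))\<bar>) = (\<Sum>j=1..n. \<bar>f (y i j) - f (y i (Suc j))\<bar>)"
      using y by (intro sum.cong) auto
    finally show ?thesis .
  qed
  have "(\<lambda>i. ereal (\<Sum>j=1..n. \<bar>f (y i j) - f (y i (Suc j))\<bar>)) \<longlonglongrightarrow> ereal (\<Sum>j=1..n. \<bar>f (x j) - f (x (Suc j))\<bar>)"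
  proof -
    have lim: "(\<lambda>i. f (y i j)) \<longlonglongrightarrow> f (x j)" if "j \<in> {1..Suc n}" for j
    proof (rule isCont_tendsto_compose[where g = f])
      show "isCont f (x j)" using cont by (simp add: continuous_on_eq_continuous_at)
      have "(\<lambda>i. x j + 1 / real (Suc i)) \<longlonglongrightarrow> x j + 0"
        by (intro tendsto_add tendsto_const LIMSEQ_Suc[OF lim_1_over_n])
      moreover have "x j \<le> y i j" "y i j \<le> x j + 1 / real (Suc i)" for i
        using y[OF that, of i] by simp_all
      ultimately show "(\<lambda>i. y i j) \<longlonglongrightarrow> x j"
        by (intro tendsto_sandwich[of "\<lambda>_. x j" "\<lambda>i. y i j" sequentially "\<lambda>i. x j + 1 / real (Suc i)"]) simp_all
    qed
    then show ?thesis
      by (intro tendsto_ereal tendsto_sum tendsto_rabs tendsto_diff lim) auto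
  qed
  then show ?thesis by (rule LIMSEQ_le_const2) (use le in blast)
qed

text \<open>The terms are the values of 1/\<open>coef\<close> where the profile is 1/q: q^2/3 for
  even q and q^2 for odd q. For odd q, hence q >= 3, the bound rests on (q+1)^2 <= 2 q^2.\<close>

lemma parity_gap:
  fixes q :: nat
  assumes "4 \<le> Suc q"
  shows "(real q)\<^sup>2 / 3 \<le> \<bar>(real (Suc q))\<^sup>2 / (2 + (-1) ^ Suc q) - (real q)\<^sup>2 / (2 + (-1) ^ q)\<bar>"
proof (cases "even q")
  case True
  have "(real q)\<^sup>2 \<le> (real (Suc q))\<^sup>2" "0 \<le> (real q)\<^sup>2" by (auto intro!: power_mono)
  moreover have "(real (Suc q))\<^sup>2 / (2 + (-1) ^ Suc q) - (real q)\<^sup>2 / (2 + (-1) ^ q) = (real (Suc q))\<^sup>2 - (real q)\<^sup>2 / 3"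
    using True by simp
  ultimately show ?thesis by linarith
next
  case False
  have "3 \<le> real q" using assms by simp
  then have "1 + 2 * real q \<le> real q * real q" using mult_right_mono[of 3 "real q" "real q"] by linarith
  then have "(real (Suc q))\<^sup>2 \<le> 2 * (real q)\<^sup>2"
    by (simp add: power2_eq_square algebra_simps)
  then have "(real q)\<^sup>2 / 3 \<le> - ((real (Suc q))\<^sup>2 / (2 + (-1) ^ Suc q) - (real q)\<^sup>2 / (2 + (-1) ^ q))"
    using False by simp
  then show ?thesis by linarith
qed

lemma coef_at_inverse_nat:
  assumes "\<rho> x = 1 / real q" "0 < q"
  shows "coef x = (2 + (-1) ^ q) / (real q)\<^sup>2"
  using assms cos_npi[of q] by (simp add: coef_def power_divide mult.commute)

text \<open>In the m-th transition zone the slice is alpha/\<open>coef\<close>, and the profile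
  takes the values 1/q for all N < q < 2N, where N = 2^m. Neighbouring values of q have opposite
  parity, so each step contributes at least a quarter of the height \<open>amp m\<close>. The bound
  is proved for every representative \<open>g\<close>.\<close>

lemma TV_blow_up:
  assumes sol: "adapted_entropy_solution flux (\<lambda>_. 0) (\<lambda>_. 0) datum u"
  shows "ess_TV (u 1) = \<infinity>"
proof -
  have "TV g = \<infinity>" if g: "AE x in lebesgue. g x = u 1 x" for g
  proof -
    have lower: "ereal ((4/3) ^ m / 72) \<le> TV g" if m: "2 \<le> m" for m
    proof -
      define b \<alpha> s where "b = - 8 * real m" and "\<alpha> = coef b * amp m" and "s = (1/4::real) ^ Suc m"
      define N :: nat where "N = 2 ^ m"
      have N: "4 \<le> N" unfolding N_def using power_increasing[OF m, of "2::nat"] by simp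
      have two: "\<rho> b = 1 / real (2 * N)" "\<rho> (b + s) = 1 / real N"
        using \<rho>_plateau[of m b] \<rho>_top[of m] by (simp_all add: b_def s_def N_def power_one_over)
      have \<alpha>0: "0 \<le> \<alpha>" using coef_pos[of b] amp_nonneg[of m] by (simp add: \<alpha>_def)
      have \<alpha>_eq: "\<alpha> = amp m * (3 / (2 * real N)\<^sup>2)"
        using coef_at_inverse_nat[OF two(1)] N by (simp add: \<alpha>_def)
      have ex: "\<exists>x. b < x \<and> x < b + s \<and> \<rho> x = 1 / real q" if q: "N < q" "q < 2 * N" for q
      proof -
        have "\<exists>x\<ge>b. x \<le> b + s \<and> \<rho> x = 1 / real q"
        proof (rule IVT')
          show "\<rho> b \<le> 1 / real q" "1 / real q \<le> \<rho> (b + s)"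
            unfolding two using q N by (auto intro!: divide_left_mono)
          show "continuous_on {b..b + s} \<rho>" using \<rho>_cont by (rule continuous_on_subset) simp
        qed (simp add: s_def)
        then obtain x where x: "b \<le> x" "x \<le> b + s" "\<rho> x = 1 / real q" by blast
        moreover have "x \<noteq> b" "x \<noteq> b + s" using x(3) two q N by auto
        ultimately show ?thesis by force
      qed
      \<comment> \<open>The N - 1 values q = 2N - j with j = 1, ..., N-1 give N - 2 increments;
        decreasing q orders the points from left to right.\<close>
      define n where "n = N - 2"
      have "\<exists>x. b < x \<and> x < b + s \<and> \<rho> x = 1 / real (2 * N - j)" if "j \<in> {1..Suc n}" for j
        using that N by (intro ex) (auto simp: n_def)
      then obtain x where x: "\<And>j. j \<in> {1..Suc n} \<Longrightarrow> b < x j \<and> x j < b + s \<and> \<rho> (x j) = 1 / real (2 * N - j)"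
        by metis
      have mono: "strict_mono_on {1..Suc n} x"
      proof (rule strict_mono_onI)
        fix j k assume jk: "j \<in> {1..Suc n}" "k \<in> {1..Suc n}" "j < k"
        then have "\<rho> (x j) < \<rho> (x k)"
          using x[OF jk(1)] x[OF jk(2)] N by (auto simp: n_def intro!: divide_strict_left_mono)
        then show "x j < x k" using \<rho>_mono[of "x k" "x j"] by linarith
      qed
      have gap: "amp m / 4 \<le> \<bar>\<alpha> / coef (x j) - \<alpha> / coef (x (Suc j))\<bar>" if j: "j \<in> {1..n}" for j
      proof -
        define q where "q = 2 * N - Suc j"
        have q: "2 * N - j = Suc q" "N \<le> q" using j N by (auto simp: q_def n_def)
        have "\<bar>\<alpha> / coef (x j) - \<alpha> / coef (x (Suc j))\<bar>
            = \<bar>\<alpha> * ((real (Suc q))\<^sup>2 / (2 + (-1) ^ Suc q)) - \<alpha> * ((real q)\<^sup>2 / (2 + (-1) ^ q))\<bar>"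
          using x[of j] x[of "Suc j"] j q N
          by (simp add: coef_at_inverse_nat[of "x j" "Suc q"] coef_at_inverse_nat[of "x (Suc j)" q] flip: q_def)
        also have "\<dots> = \<alpha> * \<bar>(real (Suc q))\<^sup>2 / (2 + (-1) ^ Suc q) - (real q)\<^sup>2 / (2 + (-1) ^ q)\<bar>"
          by (simp only: right_diff_distrib[symmetric] abs_mult abs_of_nonneg[OF \<alpha>0])
        also have "\<dots> \<ge> \<alpha> * ((real q)\<^sup>2 / 3)"
          using q N by (intro mult_left_mono parity_gap \<alpha>0) auto
        finally have 1: "\<alpha> * ((real q)\<^sup>2 / 3) \<le> \<bar>\<alpha> / coef (x j) - \<alpha> / coef (x (Suc j))\<bar>" .
        have "(real N)\<^sup>2 \<le> (real q)\<^sup>2" using q by (intro power_mono) auto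
        then have "\<alpha> * ((real N)\<^sup>2 / 3) \<le> \<alpha> * ((real q)\<^sup>2 / 3)"
          by (intro mult_left_mono \<alpha>0) auto
        moreover have "\<alpha> * ((real N)\<^sup>2 / 3) = amp m / 4"
          using N by (simp add: \<alpha>_eq power_mult_distrib)
        ultimately show ?thesis using 1 by linarith
      qed
      \<comment> \<open>2^m (2/3)^m divided by 2 * 4 * 9; the next estimate N/2 <= N - 2 uses N >=
        4.\<close>
      have "(4/3) ^ m / 72 = (real N / 2) * (amp m / 4)"
        by (simp add: N_def amp_def flip: power_mult_distrib)
      also have "\<dots> \<le> real n * (amp m / 4)"
        using N amp_nonneg[of m] by (intro mult_right_mono) (auto simp: n_def of_nat_diff)
      also have "\<dots> = (\<Sum>j=1..n. amp m / 4)" by simp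
      also have "\<dots> \<le> (\<Sum>j=1..n. \<bar>\<alpha> / coef (x j) - \<alpha> / coef (x (Suc j))\<bar>)"
        by (intro sum_mono gap)
      finally have "ereal ((4/3) ^ m / 72) \<le> ereal (\<Sum>j=1..n. \<bar>\<alpha> / coef (x j) - \<alpha> / coef (x (Suc j))\<bar>)" by simp
      also have "\<dots> \<le> TV g"
      proof (rule TV_ge_continuous[where l = b and r = "b + s", OF _ _ _ mono])
        show "continuous_on UNIV (\<lambda>x. \<alpha> / coef x)"
          using coef_pos by (intro continuous_intros coef_cont) (metis less_irrefl)
        show "AE x in lebesgue. x \<in> {b<..<b + s} \<longrightarrow> g x = \<alpha> / coef x"
          using g solution_slice[OF sol b_def \<alpha>_def s_def] by eventually_elim auto
        show "1 \<le> n" using N by (simp add: n_def)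
        show "x j \<in> {b<..<b + s}" if "j \<in> {1..Suc n}" for j using x[OF that] by simp
      qed
      finally show ?thesis .
    qed
    show "TV g = \<infinity>"
    proof (rule ereal_top)
      fix B
      obtain m where "72 * B < (4/3::real) ^ m" using real_arch_pow[of "4/3" "72 * B"] by auto
      also have "(4/3::real) ^ m \<le> (4/3) ^ (m + 2)" by (intro power_increasing) auto
      finally have "ereal B \<le> ereal ((4/3) ^ (m + 2) / 72)" by simp
      also have "\<dots> \<le> TV g" by (rule lower) simp
      finally show "ereal B \<le> TV g" .
    qed
  qed
  then show ?thesis unfolding ess_TV_def by (intro antisym INF_greatest) auto
qed

text \<open>Blow-up is obtained for every adapted entropy solution, so uniqueness is not invoked;
  the separate existence claim rules out a vacuous quantification.\<close>

theorem proposition4p1: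
  shows "\<exists>(A :: real \<Rightarrow> real \<Rightarrow> real) (\<Omega> :: real set) (um :: real \<Rightarrow> real) (up :: real \<Rightarrow> real)
            (u0 :: real \<Rightarrow> real) (T0 :: real).
     A1 A \<Omega> \<and> A2 A \<and> A3 A \<Omega> um up \<and> B1 A \<and> B2 A \<and> B3 A \<and> B4 um up \<and>
     u0 \<in> Linf lebesgue \<and> \<Lambda> A um up u0 < \<infinity> \<and> 0 < T0 \<and>
     (\<exists>u. adapted_entropy_solution A um up u0 u) \<and>
     (\<forall>u. adapted_entropy_solution A um up u0 u \<longrightarrow> ess_TV (u T0) = \<infinity>)"
proof (rule exI[of _ flux], rule exI[of _ "{}"], rule exI[of _ "\<lambda>_. 0"], rule exI[of _ "\<lambda>_. 0"],
    rule exI[of _ datum], rule exI[of _ 1], intro conjI)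
  obtain Y X where "characteristics coef Y X"
    using characteristics_exist[OF coef_cont coef_pos coef_le_3] .
  then show "\<exists>u. adapted_entropy_solution flux (\<lambda>_. 0) (\<lambda>_. 0) datum u"
    using transported_datum_solves by blast
  show "\<forall>u. adapted_entropy_solution flux (\<lambda>_. 0) (\<lambda>_. 0) datum u \<longrightarrow> ess_TV (u 1) = \<infinity>"
    using TV_blow_up by blast
qed (rule flux_A1 flux_A2 flux_A3 flux_B1 flux_B2 flux_B3 flux_B4 datum_Linf datum_\<Lambda> zero_less_one)+

end
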